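(* Consider a static axisymmetric electrovacuum spacetime of Weyl's class, with smooth $\lambda,\mu,V$ on a connected open subset of the half-plane $\{\rho>0\}$ and with non-constant electrostatic potential $V$. Let $q\in\{0,+1,-1\}$ and let $K$ be a rank-2 Killing tensor of the canonical form $$K=\lambda_0(\theta^1\otimes\theta^1+q\,\theta^2\otimes\theta^2)+\lambda_1(\theta^1\otimes\theta^2+\theta^2\otimes\theta^1)+\lambda_2(\theta^3\otimes\theta^4+\theta^4\otimes\theta^3)+\lambda_3(\theta^3\otimes\theta^3+\theta^4\otimes\theta^4),$$ where $\lambda_0,\lambda_1,\lambda_2,\lambda_3$ are smooth real functions of $(\rho,z)$, and suppose that $K$ satisfies the alignment condition with the Maxwell field, $$F_\mu{}^{(\alpha}K^{\nu)\mu}=0 .$$ Then $K$ is reducible.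
   Context: A static axisymmetric electrovacuum metric of Weyl's class is, in coordinates $(t,\phi,\rho,z)$ with $\rho>0$, $ds^2=e^{2\lambda}dt^2-e^{-2\lambda}[\rho^2d\phi^2+e^{2\mu}(d\rho^2+dz^2)]$, with Maxwell field $F_{\mu\nu}=\partial_\mu A_\nu-\partial_\nu A_\mu$, $A=V\,dt$, where $\lambda,\mu,V$ are real functions of $(\rho,z)$ satisfying $$\lambda_{\rho\rho}+\tfrac{\lambda_\rho}{\rho}+\lambda_{zz}=e^{-2\lambda}(V_\rho^2+V_z^2),\qquad V_{\rho\rho}+\tfrac{V_\rho}{\rho}+V_{zz}=2(\lambda_\rho V_\rho+\lambda_zV_z),$$ $$\mu_\rho=\rho(\lambda_\rho^2-\lambda_z^2)-\rho e^{-2\lambda}(V_\rho^2-V_z^2),\qquad \mu_z=2\rho\big[\lambda_\rho\lambda_z-e^{-2\lambda}V_\rho V_z\big].$$ The function $\lambda$ in the metric is distinct from the scalars $\lambda_0,\dots,\lambda_3$. Null coframe: $\theta^1=\frac{1}{\sqrt2}(e^{\lambda}dt+\rho e^{-\lambda}d\phi)$, $\theta^2=\frac1{\sqrt2}(e^{\lambda}dt-\rho e^{-\lambda}d\phi)$, $\theta^3=-\frac{e^{\mu-\lambda}}{\sqrt2}(d\rho-i\,dz)$, $\theta^4=-\frac{e^{\mu-\lambda}}{\sqrt2}(d\rho+i\,dz)$, so that $ds^2=2(\theta^1\theta^2-\theta^3\theta^4)$. A rank-2 Killing tensor is a symmetric tensor $K_{\mu\nu}$ with $\nabla_{(\alpha}K_{\mu\nu)}=0$.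 It is called reducible if it is a linear combination, with constant coefficients, of the metric and symmetrized products of Killing vector fields of the spacetime. *)

theory Defs
  imports "HOL-Analysis.Analysis"
begin

section \<open>Smooth functions on open sets\<close>

text \<open>
  The library has no notion of smoothness of higher order. Both definitions are meant for open
  sets, where the Frechet derivative at an interior point does not depend on values outside.
\<close>

definition dir_deriv :: "'a::real_normed_vector \<Rightarrow> ('a \<Rightarrow> 'b::real_normed_vector) \<Rightarrow> 'a \<Rightarrow> 'b"
  where "dir_deriv v f x = frechet_derivative f (at x) v"

primrec Ck_on ::
    "nat \<Rightarrow> ('a::euclidean_space \<Rightarrow> 'b::real_normed_vector) \<Rightarrow> 'a set \<Rightarrow> bool"
  where
    "Ck_on 0 f S \<longleftrightarrow> continuous_on S f"
  | "Ck_on (Suc k) f S \<longleftrightarrow>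
       (\<forall>x\<in>S. f differentiable (at x)) \<and> (\<forall>v\<in>Basis. Ck_on k (dir_deriv v f) S)"

definition smooth_on :: "('a::euclidean_space \<Rightarrow> 'b::real_normed_vector) \<Rightarrow> 'a set \<Rightarrow> bool"
  where "smooth_on f S \<longleftrightarrow> (\<forall>k. Ck_on k f S)"


section \<open>Tensor calculus in one coordinate chart\<close>

text \<open>
  A metric and a covariant rank-2 tensor are matrix-valued functions of the coordinates
  (lower indices); a vector field is given by its contravariant components.
\<close>

definition pd :: "'n::finite \<Rightarrow> (real^'n \<Rightarrow> real) \<Rightarrow> real^'n \<Rightarrow> real"
  where "pd i f x = dir_deriv (axis i 1) f x"

definition christoffel ::
    "(real^'n::finite \<Rightarrow> real^'n^'n) \<Rightarrow> real^'n \<Rightarrow> 'n \<Rightarrow> 'n \<Rightarrow> 'n \<Rightarrow> real"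
  where "christoffel g x s a b =
    (1/2) * (\<Sum>l\<in>UNIV. matrix_inv (g x) $ s $ l *
      (pd a (\<lambda>y. g y $ b $ l) x + pd b (\<lambda>y. g y $ a $ l) x - pd l (\<lambda>y. g y $ a $ b) x))"

definition cov_deriv_covector ::
    "(real^'n::finite \<Rightarrow> real^'n^'n) \<Rightarrow> (real^'n \<Rightarrow> real^'n) \<Rightarrow> real^'n \<Rightarrow> 'n \<Rightarrow> 'n \<Rightarrow> real"
  where "cov_deriv_covector g w x a m =
    pd a (\<lambda>y. w y $ m) x - (\<Sum>s\<in>UNIV. christoffel g x s a m * w x $ s)"

definition cov_deriv_tensor2 ::
    "(real^'n::finite \<Rightarrow> real^'n^'n) \<Rightarrow> (real^'n \<Rightarrow> real^'n^'n) \<Rightarrow> real^'n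
      \<Rightarrow> 'n \<Rightarrow> 'n \<Rightarrow> 'n \<Rightarrow> real"
  where "cov_deriv_tensor2 g K x a m n =
    pd a (\<lambda>y. K y $ m $ n) x
    - (\<Sum>s\<in>UNIV. christoffel g x s a m * K x $ s $ n)
    - (\<Sum>s\<in>UNIV. christoffel g x s a n * K x $ m $ s)"

definition sym2 :: "('i \<Rightarrow> 'i \<Rightarrow> real) \<Rightarrow> 'i \<Rightarrow> 'i \<Rightarrow> real"
  where "sym2 T a b = (T a b + T b a) / 2"

definition sym3 :: "('i \<Rightarrow> 'i \<Rightarrow> 'i \<Rightarrow> real) \<Rightarrow> 'i \<Rightarrow> 'i \<Rightarrow> 'i \<Rightarrow> real"
  where "sym3 T a b c = (T a b c + T b c a + T c a b + T b a c + T a c b + T c b a) / 6"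

definition lower :: "(real^'n::finite \<Rightarrow> real^'n^'n) \<Rightarrow> (real^'n \<Rightarrow> real^'n) \<Rightarrow> real^'n \<Rightarrow> real^'n"
  where "lower g X x = g x *v X x"

definition killing_vector ::
    "(real^'n::finite \<Rightarrow> real^'n^'n) \<Rightarrow> (real^'n) set \<Rightarrow> (real^'n \<Rightarrow> real^'n) \<Rightarrow> bool"
  where "killing_vector g M X \<longleftrightarrow>
    smooth_on X M \<and>
    (\<forall>x\<in>M. \<forall>a b. sym2 (cov_deriv_covector g (lower g X) x) a b = 0)"

definition killing_tensor2 ::
    "(real^'n::finite \<Rightarrow> real^'n^'n) \<Rightarrow> (real^'n) set \<Rightarrow> (real^'n \<Rightarrow> real^'n^'n) \<Rightarrow> bool"
  where "killing_tensor2 g M K \<longleftrightarrow>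
    smooth_on K M \<and>
    (\<forall>x\<in>M. \<forall>m n. K x $ m $ n = K x $ n $ m) \<and>
    (\<forall>x\<in>M. \<forall>a m n. sym3 (cov_deriv_tensor2 g K x) a m n = 0)"

definition reducible ::
    "(real^'n::finite \<Rightarrow> real^'n^'n) \<Rightarrow> (real^'n) set \<Rightarrow> (real^'n \<Rightarrow> real^'n^'n) \<Rightarrow> bool"
  where "reducible g M K \<longleftrightarrow>
    (\<exists>(c0::real) (N::nat) (c :: nat \<Rightarrow> real)
        (X :: nat \<Rightarrow> real^'n \<Rightarrow> real^'n) (Y :: nat \<Rightarrow> real^'n \<Rightarrow> real^'n).
      (\<forall>k<N. killing_vector g M (X k) \<and> killing_vector g M (Y k)) \<and>
      (\<forall>x\<in>M. \<forall>m n.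
        K x $ m $ n = c0 * g x $ m $ n
          + (\<Sum>k<N. c k * sym2 (\<lambda>i j. lower g (X k) x $ i * lower g (Y k) x $ j) m n)))"

definition maxwell :: "(real^'n::finite \<Rightarrow> real^'n) \<Rightarrow> real^'n \<Rightarrow> real^'n^'n"
  where "maxwell A x = (\<chi> m n. pd m (\<lambda>y. A y $ n) x - pd n (\<lambda>y. A y $ m) x)"

text \<open>Second index of a covariant tensor raised, and both indices raised.\<close>

definition raise_snd :: "real^'n^'n \<Rightarrow> real^'n^'n \<Rightarrow> 'n::finite \<Rightarrow> 'n \<Rightarrow> real"
  where "raise_snd G T m a = (\<Sum>b\<in>UNIV. T $ m $ b * matrix_inv G $ b $ a)"

definition raise_both :: "real^'n^'n \<Rightarrow> real^'n^'n \<Rightarrow> 'n::finite \<Rightarrow> 'n \<Rightarrow> real"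
  where "raise_both G T a b =
    (\<Sum>m\<in>UNIV. \<Sum>n\<in>UNIV. matrix_inv G $ a $ m * matrix_inv G $ b $ n * T $ m $ n)"

definition aligned ::
    "(real^'n::finite \<Rightarrow> real^'n^'n) \<Rightarrow> (real^'n) set \<Rightarrow> (real^'n \<Rightarrow> real^'n^'n)
      \<Rightarrow> (real^'n \<Rightarrow> real^'n^'n) \<Rightarrow> bool"
  where "aligned g M F K \<longleftrightarrow>
    (\<forall>x\<in>M. \<forall>a n.
      sym2 (\<lambda>i j. \<Sum>m\<in>UNIV. raise_snd (g x) (F x) m i * raise_both (g x) (K x) j m) a n = 0)"


section \<open>Static axisymmetric electrovacuum fields of Weyl's class\<close>

text \<open>
  The coordinates \<open>t, \<phi>, \<rho>, z\<close> are the components 1, 2, 3, 4 of a point of \<open>real^4\<close>; functions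
  of \<open>(\<rho>, z)\<close> have type \<open>real \<times> real \<Rightarrow> real\<close>. The coordinate \<open>\<phi>\<close> ranges over all of
  the reals, with no periodic identification: Killing vector fields are those of this
  coordinate domain, and they need not be periodic in \<open>\<phi>\<close>. (Since \<open>\<mu>\<close> is determined only up
  to an additive constant, the rotation axis may carry a conical singularity, and
  identifying \<open>\<phi>\<close> with \<open>\<phi> + 2\<pi>\<close> would then destroy Killing fields depending on \<open>\<phi>\<close>.)
\<close>

definition pt :: "real^4 \<Rightarrow> real \<times> real"
  where "pt x = (x $ 3, x $ 4)"

definition weyl_domain :: "(real \<times> real) set \<Rightarrow> (real^4) set"
  where "weyl_domain U = {x. pt x \<in> U}"

definition d_rho :: "(real \<times> real \<Rightarrow> real) \<Rightarrow> real \<times> real \<Rightarrow> real"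
  where "d_rho = dir_deriv (1, 0)"

definition d_z :: "(real \<times> real \<Rightarrow> real) \<Rightarrow> real \<times> real \<Rightarrow> real"
  where "d_z = dir_deriv (0, 1)"

definition weyl_metric ::
    "(real \<times> real \<Rightarrow> real) \<Rightarrow> (real \<times> real \<Rightarrow> real) \<Rightarrow> real^4 \<Rightarrow> real^4^4"
  where "weyl_metric lam mu x = (\<chi> i j.
    if i \<noteq> j then 0
    else if i = 1 then exp (2 * lam (pt x))
    else if i = 2 then - exp (- 2 * lam (pt x)) * (x $ 3)\<^sup>2
    else - exp (- 2 * lam (pt x)) * exp (2 * mu (pt x)))"

definition weyl_potential :: "(real \<times> real \<Rightarrow> real) \<Rightarrow> real^4 \<Rightarrow> real^4"
  where "weyl_potential V x = axis 1 (V (pt x))"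

definition weyl_electrovac ::
    "(real \<times> real) set \<Rightarrow> (real \<times> real \<Rightarrow> real) \<Rightarrow> (real \<times> real \<Rightarrow> real)
      \<Rightarrow> (real \<times> real \<Rightarrow> real) \<Rightarrow> bool"
  where "weyl_electrovac U lam mu V \<longleftrightarrow>
    open U \<and> connected U \<and> U \<subseteq> {(r, z). r > 0} \<and>
    smooth_on lam U \<and> smooth_on mu U \<and> smooth_on V U \<and>
    (\<forall>p\<in>U.
      d_rho (d_rho lam) p + d_rho lam p / fst p + d_z (d_z lam) p
        = exp (- 2 * lam p) * ((d_rho V p)\<^sup>2 + (d_z V p)\<^sup>2) \<and>
      d_rho (d_rho V) p + d_rho V p / fst p + d_z (d_z V) p
        = 2 * (d_rho lam p * d_rho V p + d_z lam p * d_z V p) \<and>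
      d_rho mu p
        = fst p * ((d_rho lam p)\<^sup>2 - (d_z lam p)\<^sup>2)
          - fst p * exp (- 2 * lam p) * ((d_rho V p)\<^sup>2 - (d_z V p)\<^sup>2) \<and>
      d_z mu p
        = 2 * fst p * (d_rho lam p * d_z lam p - exp (- 2 * lam p) * d_rho V p * d_z V p))"


section \<open>The null coframe and the canonical form\<close>

abbreviation dx :: "4 \<Rightarrow> complex^4"
  where "dx k \<equiv> axis k 1"

definition theta1 :: "(real \<times> real \<Rightarrow> real) \<Rightarrow> real^4 \<Rightarrow> complex^4"
  where "theta1 lam x = complex_of_real (1 / sqrt 2) *s
    (complex_of_real (exp (lam (pt x))) *s dx 1
      + complex_of_real (x $ 3 * exp (- lam (pt x))) *s dx 2)"

definition theta2 :: "(real \<times> real \<Rightarrow> real) \<Rightarrow> real^4 \<Rightarrow> complex^4"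
  where "theta2 lam x = complex_of_real (1 / sqrt 2) *s
    (complex_of_real (exp (lam (pt x))) *s dx 1
      - complex_of_real (x $ 3 * exp (- lam (pt x))) *s dx 2)"

definition theta3 ::
    "(real \<times> real \<Rightarrow> real) \<Rightarrow> (real \<times> real \<Rightarrow> real) \<Rightarrow> real^4 \<Rightarrow> complex^4"
  where "theta3 lam mu x =
    complex_of_real (- exp (mu (pt x) - lam (pt x)) / sqrt 2) *s (dx 3 - \<i> *s dx 4)"

definition theta4 ::
    "(real \<times> real \<Rightarrow> real) \<Rightarrow> (real \<times> real \<Rightarrow> real) \<Rightarrow> real^4 \<Rightarrow> complex^4"
  where "theta4 lam mu x =
    complex_of_real (- exp (mu (pt x) - lam (pt x)) / sqrt 2) *s (dx 3 + \<i> *s dx 4)"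

definition tensor_prod :: "complex^'n \<Rightarrow> complex^'n \<Rightarrow> 'n::finite \<Rightarrow> 'n \<Rightarrow> complex"
  where "tensor_prod a b m n = a $ m * b $ n"

lemma weyl_metric_null_coframe:
  "complex_of_real (weyl_metric lam mu x $ m $ n) =
     tensor_prod (theta1 lam x) (theta2 lam x) m n
   + tensor_prod (theta2 lam x) (theta1 lam x) m n
   - tensor_prod (theta3 lam mu x) (theta4 lam mu x) m n
   - tensor_prod (theta4 lam mu x) (theta3 lam mu x) m n"
proof -
  have s: "complex_of_real (sqrt 2) * complex_of_real (sqrt 2) = 2"
    by (simp flip: of_real_mult)
  have e: "exp (- (2 * a)) = 1 / (exp a * exp a)" "exp (2 * a) = exp a * exp a"
    "exp (- a) = 1 / exp a" "exp (b - a) = exp b / exp a" for a b :: real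
    by (simp_all add: exp_minus exp_diff divide_inverse flip: exp_add)
  show ?thesis
    using exhaust_4[of m] exhaust_4[of n]
    by (elim disjE;
        simp add: weyl_metric_def tensor_prod_def theta1_def theta2_def theta3_def theta4_def
          axis_def e s power2_eq_square field_simps)
qed

definition canonical_form ::
    "(real \<times> real \<Rightarrow> real) \<Rightarrow> (real \<times> real \<Rightarrow> real) \<Rightarrow> real
      \<Rightarrow> (real \<times> real \<Rightarrow> real) \<Rightarrow> (real \<times> real \<Rightarrow> real)
      \<Rightarrow> (real \<times> real \<Rightarrow> real) \<Rightarrow> (real \<times> real \<Rightarrow> real)
      \<Rightarrow> real^4 \<Rightarrow> 4 \<Rightarrow> 4 \<Rightarrow> complex"
  where "canonical_form lam mu q l0 l1 l2 l3 x m n =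
     complex_of_real (l0 (pt x)) *
       (tensor_prod (theta1 lam x) (theta1 lam x) m n
        + complex_of_real q * tensor_prod (theta2 lam x) (theta2 lam x) m n)
   + complex_of_real (l1 (pt x)) *
       (tensor_prod (theta1 lam x) (theta2 lam x) m n
        + tensor_prod (theta2 lam x) (theta1 lam x) m n)
   + complex_of_real (l2 (pt x)) *
       (tensor_prod (theta3 lam mu x) (theta4 lam mu x) m n
        + tensor_prod (theta4 lam mu x) (theta3 lam mu x) m n)
   + complex_of_real (l3 (pt x)) *
       (tensor_prod (theta3 lam mu x) (theta3 lam mu x) m n
        + tensor_prod (theta4 lam mu x) (theta4 lam mu x) m n)"

end

theory Submission
  imports Defs
begin

text \<open>
  In mixed components \<open>K\<close> is diagonal with eigenvalues \<open>\<kappa>\<^sub>i\<close>, up to the entry \<open>S = K\<^sub>t\<^sub>\<phi>\<close>, and the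
  Killing equation reads \<open>\<partial>\<^sub>a \<kappa>\<^sub>i = (\<partial>\<^sub>a ln g\<^sub>i\<^sub>i) (\<kappa>\<^sub>i - \<kappa>\<^sub>a)\<close> and \<open>\<partial>\<^sub>a S = (\<partial>\<^sub>a ln \<rho>\<^sup>2) S\<close>. Alignment is
  \<open>V\<^sub>\<rho> (\<kappa>\<^sub>3 - \<kappa>\<^sub>1) = V\<^sub>z (\<kappa>\<^sub>4 - \<kappa>\<^sub>1) = 0\<close> and \<open>S dV = 0\<close>. The functions \<open>S\<close> and \<open>\<kappa>\<^sub>3 - \<kappa>\<^sub>4\<close> are
  proportional to their own gradients, so each of them vanishes identically or nowhere; hence
  \<open>S = 0\<close>. If \<open>\<kappa>\<^sub>3 = \<kappa>\<^sub>4\<close>, then this common eigenvalue is constant, and subtracting its multiple of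
  the metric leaves constant multiples of the squares of \<open>\<partial>\<^sub>t\<close> and \<open>\<partial>\<^sub>\<phi>\<close>. Otherwise alignment gives
  \<open>V\<^sub>\<rho> V\<^sub>z = 0\<close>, and the same argument applied to \<open>V\<^sub>\<rho>\<close> and \<open>V\<^sub>z\<close> shows that \<open>V\<close> depends on one of
  \<open>\<rho>, z\<close> only. If \<open>V = V(\<rho>)\<close>, the field equations force \<open>\<lambda>\<^sub>z = \<mu>\<^sub>z = 0\<close>, so \<open>\<partial>\<^sub>z\<close> is a further Killing
  field. If \<open>V = V(z)\<close>, they force \<open>\<lambda>\<^sub>\<rho> \<lambda>\<^sub>z = 0\<close>: either again \<open>\<lambda>\<^sub>z = \<mu>\<^sub>z = 0\<close>, or \<open>\<lambda>\<^sub>\<rho> = 0\<close> with \<open>\<mu>\<close>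
  constant, where the translations of the flat cone in \<open>(\<rho>, \<phi>)\<close> are Killing fields whose squares
  account for \<open>\<kappa>\<^sub>3\<close>.
\<close>

section \<open>Calculus of smooth functions in the plane\<close>

lemma Ck_on_cong:
  assumes "open S" "\<And>x. x \<in> S \<Longrightarrow> f x = g x" "Ck_on k f S"
  shows "Ck_on k g S"
  using assms
proof (induction k arbitrary: f g)
  case 0
  then show ?case by (simp cong: continuous_on_cong)
next
  case (Suc k)
  have D: "(g has_derivative frechet_derivative f (at x)) (at x)" if "x \<in> S" for x
    using Suc.prems that frechet_derivative_works has_derivative_transform_within_open
    by (metis Ck_on.simps(2))
  then have "g differentiable (at x)" if "x \<in> S" for x
    using that by (auto simp: differentiable_def)
  moreover have "dir_deriv v f x = dir_deriv v g x" if "x \<in> S" for x v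
    using frechet_derivative_at[OF D[OF that]] by (simp add: dir_deriv_def)
  ultimately show ?case
    using Suc.prems Suc.IH[of "dir_deriv v f" "dir_deriv v g" for v] by auto
qed

lemma Ck_on_add:
  assumes "open S" "Ck_on k f S" "Ck_on k g S"
  shows "Ck_on k (\<lambda>x. f x + g x) S"
  using assms(2,3)
proof (induction k arbitrary: f g)
  case 0
  then show ?case by (simp add: continuous_on_add)
next
  case (Suc k)
  have "dir_deriv v (\<lambda>x. f x + g x) x = dir_deriv v f x + dir_deriv v g x" if "x \<in> S" for x v
  proof -
    have "(f has_derivative frechet_derivative f (at x)) (at x)"
      "(g has_derivative frechet_derivative g (at x)) (at x)"
      using Suc.prems that by (simp_all flip: frechet_derivative_works)
    from frechet_derivative_at[OF has_derivative_add[OF this], symmetric] show ?thesis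
      by (simp add: dir_deriv_def)
  qed
  then have "Ck_on k (dir_deriv v (\<lambda>x. f x + g x)) S" if "v \<in> Basis" for v
    using Ck_on_cong[OF assms(1), of "\<lambda>x. dir_deriv v f x + dir_deriv v g x"] Suc that by auto
  then show ?case using Suc.prems by auto
qed

lemma Ck_on_cmult:
  fixes f :: "'a::euclidean_space \<Rightarrow> real"
  assumes "open S" "Ck_on k f S"
  shows "Ck_on k (\<lambda>x. c * f x) S"
  using assms(2)
proof (induction k arbitrary: f)
  case 0
  then show ?case by (simp add: continuous_on_mult_left)
next
  case (Suc k)
  have "dir_deriv v (\<lambda>x. c * f x) x = c * dir_deriv v f x" if "x \<in> S" for x v
  proof -
    have "(f has_derivative frechet_derivative f (at x)) (at x)"
      using Suc.prems that by (simp flip: frechet_derivative_works)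
    from frechet_derivative_at[OF has_derivative_mult_right[OF this], symmetric] show ?thesis
      by (simp add: dir_deriv_def)
  qed
  then have "Ck_on k (dir_deriv v (\<lambda>x. c * f x)) S" if "v \<in> Basis" for v
    using Ck_on_cong[OF assms(1), of "\<lambda>x. c * dir_deriv v f x"] Suc that by auto
  then show ?case using Suc.prems by auto
qed

lemma smooth_on_add: "open S \<Longrightarrow> smooth_on f S \<Longrightarrow> smooth_on g S \<Longrightarrow> smooth_on (\<lambda>x. f x + g x) S"
  by (simp add: smooth_on_def Ck_on_add)

lemma smooth_on_cmult:
  fixes f :: "'a::euclidean_space \<Rightarrow> real"
  shows "open S \<Longrightarrow> smooth_on f S \<Longrightarrow> smooth_on (\<lambda>x. c * f x) S"
  by (simp add: smooth_on_def Ck_on_cmult)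

lemma smooth_on_dir_deriv: "smooth_on f S \<Longrightarrow> v \<in> Basis \<Longrightarrow> smooth_on (dir_deriv v f) S"
  unfolding smooth_on_def
proof (intro allI)
  fix k assume "\<forall>k. Ck_on k f S" "v \<in> Basis"
  from this(1)[rule_format, of "Suc k"] this(2) show "Ck_on k (dir_deriv v f) S" by simp
qed

lemma smooth_on_imp_differentiable: "smooth_on f S \<Longrightarrow> x \<in> S \<Longrightarrow> f differentiable (at x)"
  unfolding smooth_on_def by (drule spec[of _ "Suc 0"]) simp

lemma smooth_on_imp_continuous_on: "smooth_on f S \<Longrightarrow> continuous_on S f"
  unfolding smooth_on_def by (drule spec[of _ 0]) simp

lemma smooth_on_d_rho: "smooth_on f U \<Longrightarrow> smooth_on (d_rho f) U"
  by (simp add: d_rho_def smooth_on_dir_deriv Basis_prod_def)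

lemma smooth_on_d_z: "smooth_on f U \<Longrightarrow> smooth_on (d_z f) U"
  by (simp add: d_z_def smooth_on_dir_deriv Basis_prod_def)

text \<open>Total differentiability with explicit partial derivatives. As a relation it composes
  under the product, quotient and chain rules; \<open>d_rho\<close> and \<open>d_z\<close> are read
  off by \<open>has_gradD\<close>.\<close>

definition has_grad :: "(real \<times> real \<Rightarrow> real) \<Rightarrow> real \<Rightarrow> real \<Rightarrow> real \<times> real \<Rightarrow> bool"
  where "has_grad f a b p \<longleftrightarrow> (f has_derivative (\<lambda>h. fst h * a + snd h * b)) (at p)"

lemma has_grad_smooth:
  assumes "smooth_on f U" "p \<in> U"
  shows "has_grad f (d_rho f p) (d_z f p) p"
proof -
  let ?D = "frechet_derivative f (at p)"
  have D: "(f has_derivative ?D) (at p)"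
    using smooth_on_imp_differentiable[OF assms] frechet_derivative_works by blast
  then interpret linear ?D by (rule has_derivative_linear)
  have "?D h = fst h * d_rho f p + snd h * d_z f p" for h
  proof -
    have "h = fst h *\<^sub>R (1, 0) + snd h *\<^sub>R (0, 1)" by (simp add: prod_eq_iff)
    then have "?D h = ?D (fst h *\<^sub>R (1, 0) + snd h *\<^sub>R (0, 1))" by simp
    then show ?thesis
      by (simp only: add scale) (simp add: d_rho_def d_z_def dir_deriv_def)
  qed
  then have "?D = (\<lambda>h. fst h * d_rho f p + snd h * d_z f p)" by (rule ext)
  with D show ?thesis by (simp add: has_grad_def)
qed

lemma has_gradD:
  assumes "has_grad f a b p"
  shows "d_rho f p = a" "d_z f p = b"
  using frechet_derivative_at[OF assms[unfolded has_grad_def], symmetric]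
  by (simp_all add: d_rho_def d_z_def dir_deriv_def)

lemma has_grad_unique:
  assumes "has_grad f a b p" "has_grad f c d p"
  shows "a = c" "b = d"
  using has_gradD[OF assms(1)] has_gradD[OF assms(2)] by simp_all

lemma has_grad_cong:
  assumes "has_grad f a b p" "open N" "p \<in> N" "\<And>x. x \<in> N \<Longrightarrow> f x = g x"
  shows "has_grad g a b p"
  using has_derivative_transform_within_open assms unfolding has_grad_def by blast

lemma has_grad_eq: "has_grad f a b p \<Longrightarrow> a = a' \<Longrightarrow> b = b' \<Longrightarrow> has_grad f a' b' p"
  by simp

lemma has_grad_const: "has_grad (\<lambda>_. c) 0 0 p"
  by (simp add: has_grad_def)

lemma has_grad_fst: "has_grad fst 1 0 p"
  by (auto simp: has_grad_def intro!: derivative_eq_intros)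

lemma has_grad_add:
  "has_grad f a b p \<Longrightarrow> has_grad g c d p \<Longrightarrow> has_grad (\<lambda>x. f x + g x) (a + c) (b + d) p"
  unfolding has_grad_def by (drule (1) has_derivative_add) (simp add: algebra_simps)

lemma has_grad_diff:
  "has_grad f a b p \<Longrightarrow> has_grad g c d p \<Longrightarrow> has_grad (\<lambda>x. f x - g x) (a - c) (b - d) p"
  unfolding has_grad_def by (drule (1) has_derivative_diff) (simp add: algebra_simps)

lemma has_grad_minus: "has_grad f a b p \<Longrightarrow> has_grad (\<lambda>x. - f x) (- a) (- b) p"
  unfolding has_grad_def by (drule has_derivative_minus) (simp add: algebra_simps)

lemma has_grad_mult:
  "has_grad f a b p \<Longrightarrow> has_grad g c d p \<Longrightarrow>
    has_grad (\<lambda>x. f x * g x) (a * g p + f p * c) (b * g p + f p * d) p"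
  unfolding has_grad_def by (drule (1) has_derivative_mult) (simp add: algebra_simps)

lemma has_grad_divide:
  assumes "has_grad f a b p" "has_grad g c d p" "g p \<noteq> 0"
  shows "has_grad (\<lambda>x. f x / g x) ((a * g p - f p * c) / (g p)\<^sup>2) ((b * g p - f p * d) / (g p)\<^sup>2) p"
  unfolding has_grad_def
  by (rule has_derivative_eq_rhs[OF has_derivative_divide[OF assms(1,2)[unfolded has_grad_def] assms(3)]])
    (use assms(3) in \<open>auto simp: fun_eq_iff field_simps power2_eq_square\<close>)

lemma has_grad_exp: "has_grad f a b p \<Longrightarrow> has_grad (\<lambda>x. exp (f x)) (exp (f p) * a) (exp (f p) * b) p"
  unfolding has_grad_def by (drule has_derivative_exp) (simp add: algebra_simps)

lemma has_grad_zero_imp_constant: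
  assumes "open U" "connected U" "\<And>p. p \<in> U \<Longrightarrow> has_grad f 0 0 p"
  shows "\<exists>c. \<forall>p\<in>U. f p = c"
proof -
  have "f constant_on U"
  proof (rule has_derivative_zero_connected_constant_on[OF assms(2,1) finite.emptyI])
    show "continuous_on U f"
      using assms(3) has_derivative_continuous unfolding has_grad_def
      by (intro continuous_at_imp_continuous_on) blast
    show "\<forall>p\<in>U - {}. (f has_derivative (\<lambda>h. 0)) (at p within U)"
      using assms(3) by (simp add: has_grad_def has_derivative_at_withinI)
  qed
  then show ?thesis by (auto simp: constant_on_def)
qed

section \<open>Zero sets of functions proportional to their gradient\<close>

text \<open>Gronwall's argument: the bound on \<open>c\<close> makes
  \<open>(\<phi> t)\<^sup>2 * exp (- 2 * C * t)\<close> nonincreasing, and this nonnegative function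
  starts at 0.\<close>

lemma linear_ode_zero:
  fixes \<phi> :: "real \<Rightarrow> real"
  assumes "\<And>t. 0 \<le> t \<Longrightarrow> t \<le> 1 \<Longrightarrow> (\<phi> has_real_derivative \<phi> t * c t) (at t)"
    and "\<And>t. 0 \<le> t \<Longrightarrow> t \<le> 1 \<Longrightarrow> c t \<le> C" and "\<phi> 0 = 0"
  shows "\<phi> 1 = 0"
proof -
  let ?g = "\<lambda>t. (\<phi> t)\<^sup>2 * exp (- 2 * C * t)"
  have "?g 1 \<le> ?g 0"
  proof (rule DERIV_nonpos_imp_nonincreasing[where f = ?g])
    fix t :: real assume t: "0 \<le> t" "t \<le> 1"
    have "(?g has_real_derivative 2 * (\<phi> t)\<^sup>2 * (c t - C) * exp (- 2 * C * t)) (at t)"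
      by (rule derivative_eq_intros assms(1)[OF t] refl)+ (simp add: algebra_simps power2_eq_square)
    moreover have "2 * (\<phi> t)\<^sup>2 * (c t - C) * exp (- 2 * C * t) \<le> 0"
      using assms(2)[OF t] by (intro mult_nonpos_nonneg mult_nonneg_nonpos) auto
    ultimately show "\<exists>y. (?g has_real_derivative y) (at t) \<and> y \<le> 0" by blast
  qed simp
  then show ?thesis using assms(3) by (simp add: mult_le_0_iff)
qed

text \<open>The zero set is relatively closed by continuity, and open because on a segment issuing
  from a zero \<open>f\<close> solves a linear ODE with bounded coefficient. Connectedness does the
  rest.\<close>

lemma proportional_grad_vanishes:
  assumes "open U" "connected U"
    and grad: "\<And>p. p \<in> U \<Longrightarrow> has_grad f (f p * u p) (f p * v p) p"
    and cont: "continuous_on U u" "continuous_on U v"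
    and "p \<in> U" "f p = 0" "x \<in> U"
  shows "f x = 0"
proof (rule ccontr)
  assume "f x \<noteq> 0"
  let ?Z = "{p \<in> U. f p = 0}" and ?N = "{p \<in> U. f p \<noteq> 0}"
  have "continuous_on U f"
    using grad has_derivative_continuous unfolding has_grad_def
    by (intro continuous_at_imp_continuous_on) blast
  then have "open ?N"
    using continuous_open_preimage[OF _ \<open>open U\<close>, of f "- {0}"]
    by (simp add: vimage_def Int_def open_Compl)
  moreover have "open ?Z"
  proof (subst open_subopen, intro ballI)
    fix p assume p: "p \<in> ?Z"
    then obtain e where e: "e > 0" "cball p e \<subseteq> U"
      using \<open>open U\<close> open_contains_cball by blast
    \<comment> \<open>Compactness gives one bound for the coefficients on all segments from the
      centre.\<close>
    have "compact ((\<lambda>p. \<bar>u p\<bar> + \<bar>v p\<bar>) ` cball p e)"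
      using e(2) cont
      by (intro compact_continuous_image continuous_intros) (auto intro: continuous_on_subset)
    then have "bounded ((\<lambda>p. \<bar>u p\<bar> + \<bar>v p\<bar>) ` cball p e)" by (rule compact_imp_bounded)
    then obtain B where B0: "\<forall>y\<in>cball p e. norm (\<bar>u y\<bar> + \<bar>v y\<bar>) \<le> B"
      unfolding bounded_iff by blast
    have B: "\<bar>u y\<bar> + \<bar>v y\<bar> \<le> B" if "y \<in> cball p e" for y
      using B0[rule_format, OF that] by simp
    have "f y = 0" if y: "y \<in> ball p e" for y
    proof -
      define h where "h = y - p"
      have seg: "p + t *\<^sub>R h \<in> cball p e" if "0 \<le> t" "t \<le> 1" for t
      proof -
        have "norm (t *\<^sub>R h) \<le> 1 * norm h" using that by (simp add: mult_left_le_one_le)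
        also have "\<dots> \<le> e" using y by (simp add: h_def dist_norm norm_minus_commute)
        finally show ?thesis by (simp add: dist_norm)
      qed
      \<comment> \<open>The derivative of \<open>f\<close> along the segment is \<open>f\<close>
        times this factor.\<close>
      define c where "c t = fst h * u (p + t *\<^sub>R h) + snd h * v (p + t *\<^sub>R h)" for t
      have "f (p + 1 *\<^sub>R h) = 0"
      proof (rule linear_ode_zero[where \<phi> = "\<lambda>t. f (p + t *\<^sub>R h)" and c = c
            and C = "(\<bar>fst h\<bar> + \<bar>snd h\<bar>) * B"])
        fix t :: real assume t: "0 \<le> t" "t \<le> 1"
        have "(f has_derivative (\<lambda>k. fst k * (f (p + t *\<^sub>R h) * u (p + t *\<^sub>R h))
            + snd k * (f (p + t *\<^sub>R h) * v (p + t *\<^sub>R h)))) (at (p + t *\<^sub>R h))"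
          using grad seg[OF t] e(2) unfolding has_grad_def by blast
        moreover have "((\<lambda>t. p + t *\<^sub>R h) has_derivative (\<lambda>s. s *\<^sub>R h)) (at t)"
          by (auto intro!: derivative_eq_intros)
        ultimately have "((\<lambda>t. f (p + t *\<^sub>R h)) has_derivative
            (\<lambda>s. fst (s *\<^sub>R h) * (f (p + t *\<^sub>R h) * u (p + t *\<^sub>R h))
            + snd (s *\<^sub>R h) * (f (p + t *\<^sub>R h) * v (p + t *\<^sub>R h)))) (at t)"
          by (rule has_derivative_compose[rotated])
        then show "((\<lambda>t. f (p + t *\<^sub>R h)) has_real_derivative f (p + t *\<^sub>R h) * c t) (at t)"
          unfolding has_field_derivative_def
          by (rule has_derivative_eq_rhs) (auto simp: c_def algebra_simps)
        have "c t \<le> \<bar>fst h\<bar> * \<bar>u (p + t *\<^sub>R h)\<bar> + \<bar>snd h\<bar> * \<bar>v (p + t *\<^sub>R h)\<bar>"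
          unfolding c_def by (metis abs_ge_self abs_mult add_mono)
        also have "\<dots> \<le> \<bar>fst h\<bar> * B + \<bar>snd h\<bar> * B"
          using B[OF seg[OF t]] by (intro add_mono mult_left_mono) auto
        finally show "c t \<le> (\<bar>fst h\<bar> + \<bar>snd h\<bar>) * B" by (simp add: algebra_simps)
      qed (use p in simp)
      then show ?thesis by (simp add: h_def)
    qed
    then show "\<exists>T. open T \<and> p \<in> T \<and> T \<subseteq> ?Z"
      using e ball_subset_cball by (intro exI[of _ "ball p e"]) auto
  qed
  moreover have "?Z \<inter> ?N = {}" "U \<subseteq> ?Z \<union> ?N" by auto
  ultimately show False
    using \<open>connected U\<close> assms(6-8) \<open>f x \<noteq> 0\<close> unfolding connected_def by blast
qed

section \<open>Symmetry of second derivatives\<close>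

text \<open>The mean value theorem is applied to \<open>f t (z + h) - f t z\<close> in
  \<open>t\<close>, then to \<open>fx x\<close> in the other variable. The curried form allows a
  second use with the variables exchanged.\<close>

lemma double_difference_mean_value:
  fixes f :: "real \<Rightarrow> real \<Rightarrow> real"
  assumes "h > 0"
    and fx: "\<And>x y. r \<le> x \<Longrightarrow> x \<le> r + h \<Longrightarrow> z \<le> y \<Longrightarrow> y \<le> z + h \<Longrightarrow>
      ((\<lambda>t. f t y) has_real_derivative fx x y) (at x)"
    and fxy: "\<And>x y. r \<le> x \<Longrightarrow> x \<le> r + h \<Longrightarrow> z \<le> y \<Longrightarrow> y \<le> z + h \<Longrightarrow>
      ((\<lambda>t. fx x t) has_real_derivative fxy x y) (at y)"
  shows "\<exists>x y. r \<le> x \<and> x \<le> r + h \<and> z \<le> y \<and> y \<le> z + h \<and>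
    f (r + h) (z + h) - f (r + h) z - f r (z + h) + f r z = h * h * fxy x y"
proof -
  have "\<exists>x>r. x < r + h \<and> (f (r + h) (z + h) - f (r + h) z) - (f r (z + h) - f r z)
      = (r + h - r) * (fx x (z + h) - fx x z)"
    using assms(1)
    by (intro MVT2[where f = "\<lambda>t. f t (z + h) - f t z"]) (auto intro!: DERIV_diff fx)
  then obtain x where x: "r < x" "x < r + h"
    "(f (r + h) (z + h) - f (r + h) z) - (f r (z + h) - f r z) = h * (fx x (z + h) - fx x z)"
    by auto
  have "\<exists>y>z. y < z + h \<and> fx x (z + h) - fx x z = (z + h - z) * fxy x y"
    using assms(1) x by (intro MVT2) (auto intro!: fxy)
  then obtain y where "z < y" "y < z + h" "fx x (z + h) - fx x z = h * fxy x y"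
    by auto
  with x show ?thesis by (intro exI[of _ x] exI[of _ y]) (auto simp: algebra_simps)
qed

lemma has_grad_partials:
  assumes "has_grad f a b (x, y)"
  shows "((\<lambda>t. f (t, y)) has_real_derivative a) (at x)"
    and "((\<lambda>t. f (x, t)) has_real_derivative b) (at y)"
proof -
  have "((\<lambda>t. (t, y)) has_derivative (\<lambda>s. (s, 0))) (at x)"
    and "((\<lambda>t. (x, t)) has_derivative (\<lambda>s. (0, s))) (at y)"
    by (auto intro!: derivative_eq_intros)
  from this[THEN has_derivative_compose, OF assms[unfolded has_grad_def]]
  show "((\<lambda>t. f (t, y)) has_real_derivative a) (at x)"
    and "((\<lambda>t. f (x, t)) has_real_derivative b) (at y)"
    by (auto simp: has_field_derivative_def fun_eq_iff mult.commute elim!: has_derivative_eq_rhs)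
qed

text \<open>The second difference over a small square is \<open>h * h\<close> times either mixed
  partial at some point of the square; continuity at \<open>p\<close> then excludes different
  values.\<close>

lemma mixed_partials_commute:
  assumes "open U" "smooth_on f U" "p \<in> U"
  shows "d_rho (d_z f) p = d_z (d_rho f) p"
proof (rule ccontr)
  let ?d = "\<lambda>q. d_rho (d_z f) q - d_z (d_rho f) q"
  assume "\<not> ?thesis"
  then have d0: "?d p \<noteq> 0" by simp
  have cont: "continuous_on U (d_rho (d_z f))" "continuous_on U (d_z (d_rho f))"
    using assms(2) by (intro smooth_on_imp_continuous_on smooth_on_d_rho smooth_on_d_z; assumption)+
  let ?x = "d_rho (d_z f)" and ?y = "d_z (d_rho f)"
  let ?e = "\<bar>?d p\<bar> / 2"
  have "isCont ?x p" "isCont ?y p"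
    using cont assms(1,3) continuous_on_eq_continuous_at by blast+
  then obtain \<delta>1 \<delta>2 where \<delta>: "\<delta>1 > 0" "\<And>q. dist q p < \<delta>1 \<Longrightarrow> dist (?x q) (?x p) < ?e"
    "\<delta>2 > 0" "\<And>q. dist q p < \<delta>2 \<Longrightarrow> dist (?y q) (?y p) < ?e"
    using d0 unfolding continuous_at_eps_delta by (metis half_gt_zero zero_less_abs_iff)
  obtain \<delta>3 where \<delta>3: "\<delta>3 > 0" "ball p \<delta>3 \<subseteq> U" using assms(1,3) open_contains_ball by blast
  \<comment> \<open>Points of the square of side \<open>h\<close> are at distance at most
    \<open>2 * h\<close> from its corner \<open>p\<close>, so the square stays in \<open>U\<close>
    and in both continuity balls.\<close>
  define h where "h = min \<delta>1 (min \<delta>2 \<delta>3) / 3"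
  have h: "h > 0" "3 * h \<le> \<delta>1" "3 * h \<le> \<delta>2" "3 * h \<le> \<delta>3"
    using \<delta> \<delta>3 by (auto simp: h_def)
  obtain r z where p: "p = (r, z)" by (cases p)
  have box: "dist (x, y) p < 3 * h"
    if "r \<le> x" "x \<le> r + h" "z \<le> y" "y \<le> z + h" for x y
  proof -
    have "dist (x, y) p \<le> \<bar>x - r\<bar> + \<bar>y - z\<bar>"
      by (simp add: p dist_prod_def dist_real_def sqrt_sum_squares_le_sum_abs)
    also have "\<dots> < 3 * h" using that h by simp
    finally show ?thesis .
  qed
  have inU: "(x, y) \<in> U" if "r \<le> x" "x \<le> r + h" "z \<le> y" "y \<le> z + h" for x y
    using box[OF that] h \<delta>3 by (auto simp: dist_commute subset_iff)
  note G = has_grad_partials[OF has_grad_smooth]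
  have "\<exists>x y. r \<le> x \<and> x \<le> r + h \<and> z \<le> y \<and> y \<le> z + h \<and>
    f (r + h, z + h) - f (r + h, z) - f (r, z + h) + f (r, z) = h * h * ?y (x, y)"
    using h(1) assms(2)
    by (intro double_difference_mean_value[where f = "\<lambda>x y. f (x, y)" and fx = "\<lambda>x y. d_rho f (x, y)"])
      (auto intro!: G smooth_on_d_rho inU)
  \<comment> \<open>The same second difference, with the two coordinates in exchanged roles.\<close>
  moreover have "\<exists>y x. z \<le> y \<and> y \<le> z + h \<and> r \<le> x \<and> x \<le> r + h \<and>
    f (r + h, z + h) - f (r, z + h) - f (r + h, z) + f (r, z) = h * h * ?x (x, y)"
    using h(1) assms(2)
    by (intro double_difference_mean_value[where f = "\<lambda>y x. f (x, y)" and fx = "\<lambda>y x. d_z f (x, y)"])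
      (auto intro!: G smooth_on_d_z inU)
  ultimately obtain x y x' y' where
    "dist (x, y) p < 3 * h" "dist (x', y') p < 3 * h" "h * h * ?y (x, y) = h * h * ?x (x', y')"
    using box by (smt (verit))
  moreover from this have "dist (?y (x, y)) (?y p) < ?e" "dist (?x (x', y')) (?x p) < ?e"
    using h \<delta>(2)[of "(x', y')"] \<delta>(4)[of "(x, y)"] by linarith+
  ultimately have "?y (x, y) = ?x (x', y')" "dist (?y (x, y)) (?y p) < ?e" "dist (?x (x', y')) (?x p) < ?e"
    using h(1) by simp_all
  then have "\<bar>?d p\<bar> < ?e + ?e" unfolding dist_real_def by linarith
  then show False by simp
qed

section \<open>Tensor calculus of the Weyl metric\<close>

lemma pd_eq: "(f has_derivative D) (at x) \<Longrightarrow> pd i f x = D (axis i 1)"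
  unfolding pd_def dir_deriv_def by (metis frechet_derivative_at)

lemma has_derivative_pt: "(pt has_derivative pt) (at x)"
  unfolding pt_def
  by (intro bounded_linear_imp_has_derivative bounded_linear_Pair bounded_linear_vec_nth)

lemma has_grad_compose_pt:
  "has_grad f a b (pt x) \<Longrightarrow> ((\<lambda>y. f (pt y)) has_derivative (\<lambda>h. h $ 3 * a + h $ 4 * b)) (at x)"
  unfolding has_grad_def by (drule has_derivative_compose[OF has_derivative_pt]) (simp add: pt_def)

lemma pd_compose_pt:
  "has_grad f a b (pt x) \<Longrightarrow> pd i (\<lambda>y. f (pt y)) x = (if i = 3 then a else if i = 4 then b else 0)"
  by (subst pd_eq[OF has_grad_compose_pt]) (auto simp: axis_def)

lemma pd_cong:
  assumes "open M" "x \<in> M" "\<And>y. y \<in> M \<Longrightarrow> f y = g y" "f differentiable (at x)"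
  shows "pd i g x = pd i f x"
proof -
  have "(f has_derivative frechet_derivative f (at x)) (at x)"
    using assms(4) by (simp flip: frechet_derivative_works)
  moreover from this have "(g has_derivative frechet_derivative f (at x)) (at x)"
    using assms(1-3) has_derivative_transform_within_open by blast
  ultimately show ?thesis by (simp add: pd_eq)
qed

text \<open>\<open>matrix_inv\<close> is a chosen inverse: \<open>?B\<close> witnesses that one
  exists, and multiplying by \<open>?B\<close> from the left identifies the chosen one.\<close>

lemma matrix_inv_diagonal:
  fixes d :: "'n::finite \<Rightarrow> real"
  assumes "\<And>i. d i \<noteq> 0"
  shows "matrix_inv (\<chi> i j. if i = j then d i else 0) = (\<chi> i j. if i = j then 1 / d i else 0)"
proof -
  let ?A = "\<chi> i j. if i = j then d i else 0" and ?B = "\<chi> i j. if i = j then 1 / d i else 0"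
  have AB: "?A ** ?B = mat 1" "?B ** ?A = mat 1"
    using assms
    by (simp_all add: matrix_matrix_mult_def mat_def vec_eq_iff mult_delta_left mult_delta_right)
  then have "?A ** matrix_inv ?A = mat 1"
    unfolding matrix_inv_def by (rule_tac someI2[of _ ?B]) auto
  then have "?B ** (?A ** matrix_inv ?A) = ?B" by simp
  then show ?thesis by (simp add: matrix_mul_assoc AB)
qed

text \<open>The metric entries as functions of the half-plane, with \<open>fst p\<close> for the
  radius, so that the \<open>has_grad\<close> rules apply.\<close>

definition weyl_diag ::
    "(real \<times> real \<Rightarrow> real) \<Rightarrow> (real \<times> real \<Rightarrow> real) \<Rightarrow> 4 \<Rightarrow> real \<times> real \<Rightarrow> real"
  where "weyl_diag lam mu i p =
    (if i = 1 then exp (2 * lam p)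
     else if i = 2 then - exp (- 2 * lam p) * (fst p)\<^sup>2
     else - exp (- 2 * lam p) * exp (2 * mu p))"

text \<open>Half the logarithmic derivative of the \<open>i\<close>-th diagonal entry along the \<open>a\<close>-th coordinate.\<close>

definition weyl_dlog ::
    "(real \<times> real \<Rightarrow> real) \<Rightarrow> (real \<times> real \<Rightarrow> real) \<Rightarrow> 4 \<Rightarrow> 4 \<Rightarrow> real \<times> real \<Rightarrow> real"
  where "weyl_dlog lam mu i a p =
    (if a = 3 then
       (if i = 1 then d_rho lam p else if i = 2 then 1 / fst p - d_rho lam p
        else d_rho mu p - d_rho lam p)
     else if a = 4 then
       (if i = 1 then d_z lam p else if i = 2 then - d_z lam p else d_z mu p - d_z lam p)
     else 0)"

lemma weyl_metric_diag:
  "weyl_metric lam mu x = (\<chi> i j. if i = j then weyl_diag lam mu i (pt x) else 0)"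
  by (simp add: weyl_metric_def weyl_diag_def vec_eq_iff pt_def)

lemma open_weyl_domain: "open U \<Longrightarrow> open (weyl_domain U)"
proof -
  assume "open U"
  then have "open (pt -` U)"
    by (rule open_vimage) (auto simp: pt_def intro!: continuous_intros)
  then show ?thesis by (simp add: weyl_domain_def vimage_def)
qed

locale weyl =
  fixes U :: "(real \<times> real) set" and lam mu V :: "real \<times> real \<Rightarrow> real"
  assumes electrovac: "weyl_electrovac U lam mu V"
begin

abbreviation "G \<equiv> weyl_diag lam mu"
abbreviation "L \<equiv> weyl_dlog lam mu"
abbreviation "M \<equiv> weyl_domain U"
abbreviation "g \<equiv> weyl_metric lam mu"

lemma open_U: "open U" and connected_U: "connected U" and fst_pos: "p \<in> U \<Longrightarrow> fst p > 0"
  and smooth: "smooth_on lam U" "smooth_on mu U" "smooth_on V U"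
  using electrovac unfolding weyl_electrovac_def by auto

lemmas open_M = open_weyl_domain[OF open_U]

lemma pt_in: "x \<in> M \<longleftrightarrow> pt x \<in> U" by (simp add: weyl_domain_def)

lemma lam_grad: "p \<in> U \<Longrightarrow> has_grad lam (d_rho lam p) (d_z lam p) p"
  and mu_grad: "p \<in> U \<Longrightarrow> has_grad mu (d_rho mu p) (d_z mu p) p"
  and V_grad: "p \<in> U \<Longrightarrow> has_grad V (d_rho V p) (d_z V p) p"
  using smooth by (simp_all add: has_grad_smooth)

lemma G_nonzero: "p \<in> U \<Longrightarrow> G i p \<noteq> 0"
  using fst_pos[of p] by (simp add: weyl_diag_def)

lemma G_grad:
  assumes p: "p \<in> U"
  shows "has_grad (G i) (2 * L i 3 p * G i p) (2 * L i 4 p * G i p) p"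
proof -
  note exp_lam = has_grad_exp[OF has_grad_mult[OF has_grad_const lam_grad[OF p]]]
    and exp_mu = has_grad_exp[OF has_grad_mult[OF has_grad_const mu_grad[OF p]]]
  consider "i = 1" | "i = 2" | "i = 3 \<or> i = 4" using exhaust_4[of i] by blast
  then show ?thesis
  proof cases
    case 1
    then have G: "G i = (\<lambda>p. exp (2 * lam p))" by (simp add: fun_eq_iff weyl_diag_def)
    show ?thesis
      unfolding G by (rule has_grad_eq[OF exp_lam]) (simp_all add: 1 weyl_dlog_def)
  next
    case 2
    then have G: "G i = (\<lambda>p. (- exp ((-2) * lam p)) * (fst p * fst p))"
      by (simp add: fun_eq_iff weyl_diag_def power2_eq_square)
    show ?thesis
      unfolding G
      by (rule has_grad_eq[OF has_grad_mult[OF has_grad_minus[OF exp_lam]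
            has_grad_mult[OF has_grad_fst has_grad_fst]]])
        (use fst_pos[OF p] in \<open>simp_all add: 2 weyl_dlog_def field_simps\<close>)
  next
    case 3
    then have G: "G i = (\<lambda>p. (- exp ((-2) * lam p)) * exp (2 * mu p))"
      by (auto simp: fun_eq_iff weyl_diag_def)
    show ?thesis
      unfolding G by (rule has_grad_eq[OF has_grad_mult[OF has_grad_minus[OF exp_lam] exp_mu]])
        (use 3 in \<open>auto simp: weyl_dlog_def algebra_simps\<close>)
  qed
qed

lemma L_zero: "L i 1 p = 0" "L i 2 p = 0"
  by (simp_all add: weyl_dlog_def)

lemma pd_metric: "x \<in> M \<Longrightarrow> pd a (\<lambda>y. g y $ i $ j) x = (if i = j then 2 * L i a (pt x) * G i (pt x) else 0)"
  using exhaust_4[of a] pd_compose_pt[OF has_grad_const[of 0], of a x]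
    pd_compose_pt[where x = x and i = a, OF G_grad[where i = i]]
  by (auto simp: weyl_metric_diag pt_in L_zero)

lemma matrix_inv_g: "x \<in> M \<Longrightarrow> matrix_inv (g x) = (\<chi> i j. if i = j then 1 / G i (pt x) else 0)"
  unfolding weyl_metric_diag by (rule matrix_inv_diagonal) (simp add: G_nonzero pt_in)

text \<open>The inverse metric is diagonal, so only the summand \<open>l = s\<close> survives, and
  \<open>pd_metric\<close> expresses the derivatives of the entries through
  \<open>L\<close>.\<close>

lemma christoffel_eq:
  assumes "x \<in> M"
  shows "christoffel g x s a b = (if b = s then L s a (pt x) else 0) + (if a = s then L s b (pt x) else 0)
    - (if a = b then L a s (pt x) * G a (pt x) / G s (pt x) else 0)"
proof -
  have "christoffel g x s a b = (1/2) * (1 / G s (pt x) *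
    (pd a (\<lambda>y. g y $ b $ s) x + pd b (\<lambda>y. g y $ a $ s) x - pd s (\<lambda>y. g y $ a $ b) x))"
    unfolding christoffel_def matrix_inv_g[OF assms]
    by (simp add: mult_delta_left)
  then show ?thesis
    using assms G_nonzero[of "pt x" s] by (auto simp: pd_metric pt_in field_simps)
qed

end

lemma differentiable_compose_pt: "has_grad f a b (pt x) \<Longrightarrow> (\<lambda>y. f (pt y)) differentiable (at x)"
  using has_grad_compose_pt unfolding differentiable_def by blast

section \<open>Killing and alignment equations in components\<close>

context weyl begin

text \<open>The components (i, i, 3) and (i, i, 4) of the symmetrized derivative give the equations
  for \<open>\<kappa> i\<close>; the components (1, 2, 3) and (1, 2, 4) give those for
  \<open>S\<close>.\<close>

lemma killing_tensor_equations:
  assumes K: "killing_tensor2 g M K"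
    and diag: "\<And>x i. x \<in> M \<Longrightarrow> K x $ i $ i = \<kappa> i (pt x) * G i (pt x)"
    and off: "\<And>x. x \<in> M \<Longrightarrow> K x $ 1 $ 2 = S (pt x)"
      "\<And>x i j. x \<in> M \<Longrightarrow> i \<noteq> j \<Longrightarrow> {i, j} \<noteq> {1, 2} \<Longrightarrow> K x $ i $ j = 0"
    and grad: "\<And>i. has_grad (\<kappa> i) (d_rho (\<kappa> i) p) (d_z (\<kappa> i) p) p" "has_grad S (d_rho S p) (d_z S p) p"
    and p: "p \<in> U"
  shows "d_rho (\<kappa> i) p = 2 * L i 3 p * (\<kappa> i p - \<kappa> 3 p)"
    and "d_z (\<kappa> i) p = 2 * L i 4 p * (\<kappa> i p - \<kappa> 4 p)"
    and "d_rho S p = S p * (2 / fst p)" and "d_z S p = 0"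
proof -
  \<comment> \<open>A point above \<open>p\<close> at which the tensor equation is evaluated; its
    first two coordinates may be anything, here \<open>snd p\<close>.\<close>
  define x :: "real^4" where "x = (\<chi> i. if i = 3 then fst p else snd p)"
  have x: "pt x = p" "x \<in> M" using p by (simp_all add: x_def pt_def weyl_domain_def)
  have sym: "K y $ m $ n = K y $ n $ m" if "y \<in> M" for y m n
    using K that by (simp add: killing_tensor2_def)
  have kill: "sym3 (cov_deriv_tensor2 g K x) a m n = 0" for a m n
    using K x by (simp add: killing_tensor2_def)
  have pd_off: "pd a (\<lambda>y. K y $ m $ n) x = 0" if "m \<noteq> n" "{m, n} \<noteq> {1, 2}" for a m n
    using pd_cong[OF open_M x(2), of "\<lambda>_. 0" "\<lambda>y. K y $ m $ n" a] off(2) that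
    by (simp add: pd_def dir_deriv_def frechet_derivative_const)
  have pd_S: "pd a (\<lambda>y. K y $ m $ n) x = (if a = 3 then d_rho S p else if a = 4 then d_z S p else 0)"
    if "m = 1 \<and> n = 2 \<or> m = 2 \<and> n = 1" for a m n
  proof -
    have "pd a (\<lambda>y. K y $ m $ n) x = pd a (\<lambda>y. S (pt y)) x"
      using that off(1) sym[of _ 1 2] differentiable_compose_pt[of S _ _ x] grad(2) x
      by (intro pd_cong[OF open_M x(2)]) auto
    then show ?thesis using pd_compose_pt[of S _ _ x] grad(2) x by simp
  qed
  have kG: "has_grad (\<lambda>q. \<kappa> i q * G i q)
      (d_rho (\<kappa> i) p * G i p + \<kappa> i p * (2 * L i 3 p * G i p))
      (d_z (\<kappa> i) p * G i p + \<kappa> i p * (2 * L i 4 p * G i p)) p" for i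
    by (rule has_grad_mult[OF grad(1) G_grad[OF p]])
  have pd_diag: "pd a (\<lambda>y. K y $ i $ i) x =
      (if a = 3 then d_rho (\<kappa> i) p * G i p + \<kappa> i p * (2 * L i 3 p * G i p)
       else if a = 4 then d_z (\<kappa> i) p * G i p + \<kappa> i p * (2 * L i 4 p * G i p) else 0)" for a i
  proof -
    have "pd a (\<lambda>y. K y $ i $ i) x = pd a (\<lambda>y. \<kappa> i (pt y) * G i (pt y)) x"
      using diag differentiable_compose_pt[of "\<lambda>q. \<kappa> i q * G i q" _ _ x] kG[of i] x
      by (intro pd_cong[OF open_M x(2)]) auto
    then show ?thesis using pd_compose_pt[of "\<lambda>q. \<kappa> i q * G i q" _ _ x] kG x by simp
  qed
  note nz = G_nonzero[OF p, of 1] G_nonzero[OF p, of 2] G_nonzero[OF p, of 3] G_nonzero[OF p, of 4]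
  have K_off: "K x $ i $ j = 0" if "i \<noteq> j" "{i, j} \<noteq> {1, 2}" for i j
    using off(2)[OF x(2)] that by blast
  have K_12: "K x $ 1 $ 2 = S p" "K x $ 2 $ 1 = S p" using off(1)[OF x(2)] sym[OF x(2), of 2 1] x by auto
  have K_diag: "K x $ j $ j = \<kappa> j p * G j p" for j using diag[OF x(2)] x by simp
  have d3: "d_rho (\<kappa> i) p * G i p = 2 * L i 3 p * (\<kappa> i p - \<kappa> 3 p) * G i p"
    using exhaust_4[of i] kill[of i i 3] nz
    by (elim disjE) (simp_all add: sym3_def cov_deriv_tensor2_def christoffel_eq[OF x(2)] x
      pd_off pd_diag pd_S K_off K_12 K_diag L_zero sum_4 doubleton_eq_iff field_simps)
  have d4: "d_z (\<kappa> i) p * G i p = 2 * L i 4 p * (\<kappa> i p - \<kappa> 4 p) * G i p"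
    using exhaust_4[of i] kill[of i i 4] nz
    by (elim disjE) (simp_all add: sym3_def cov_deriv_tensor2_def christoffel_eq[OF x(2)] x
      pd_off pd_diag pd_S K_off K_12 K_diag L_zero sum_4 doubleton_eq_iff field_simps)
  show "d_rho (\<kappa> i) p = 2 * L i 3 p * (\<kappa> i p - \<kappa> 3 p)"
    "d_z (\<kappa> i) p = 2 * L i 4 p * (\<kappa> i p - \<kappa> 4 p)"
    using d3 d4 G_nonzero[OF p, of i] by simp_all
  \<comment> \<open>The coefficient is \<open>2 * (L 1 3 p + L 2 3 p)\<close>, where
    \<open>lam\<close> cancels and leaves \<open>2 / fst p\<close>. In the other direction the
    corresponding sum is 0.\<close>
  show "d_rho S p = S p * (2 / fst p)"
    using kill[of 1 2 3] nz fst_pos[OF p]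
    by (simp add: sym3_def cov_deriv_tensor2_def christoffel_eq[OF x(2)] x
      pd_off pd_S K_off K_12 K_diag L_zero sum_4 doubleton_eq_iff) (simp add: weyl_dlog_def field_simps)
  show "d_z S p = 0"
    using kill[of 1 2 4] nz
    by (simp add: sym3_def cov_deriv_tensor2_def christoffel_eq[OF x(2)] x
      pd_off pd_S K_off K_12 K_diag L_zero sum_4 doubleton_eq_iff) (simp add: weyl_dlog_def field_simps)
qed

lemma maxwell_weyl:
  assumes "x \<in> M"
  shows "maxwell (weyl_potential V) x $ m $ n =
    (if n = 1 then (if m = 3 then d_rho V (pt x) else if m = 4 then d_z V (pt x) else 0) else 0)
    - (if m = 1 then (if n = 3 then d_rho V (pt x) else if n = 4 then d_z V (pt x) else 0) else 0)"
proof -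
  have "pd i (\<lambda>y. weyl_potential V y $ j) x =
      (if j = 1 then (if i = 3 then d_rho V (pt x) else if i = 4 then d_z V (pt x) else 0) else 0)" for i j
    using pd_compose_pt[OF V_grad, of x i] pd_compose_pt[OF has_grad_const[of 0], of i x] assms
    by (auto simp: weyl_potential_def axis_def pt_in)
  then show ?thesis by (simp add: maxwell_def)
qed

text \<open>The Maxwell tensor only couples index 1 with 3 and 4, so the components (1, 3) and (1,
  4) compare eigenvalues, while (2, 3) and (2, 4) isolate \<open>S\<close>.\<close>

lemma aligned_equations:
  assumes al: "aligned g M (maxwell (weyl_potential V)) K"
    and diag: "\<And>x i. x \<in> M \<Longrightarrow> K x $ i $ i = \<kappa> i (pt x) * G i (pt x)"
    and off: "\<And>x. x \<in> M \<Longrightarrow> K x $ 2 $ 1 = S (pt x)"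
      "\<And>x i j. x \<in> M \<Longrightarrow> i \<noteq> j \<Longrightarrow> {i, j} \<noteq> {1, 2} \<Longrightarrow> K x $ i $ j = 0"
    and p: "p \<in> U"
  shows "d_rho V p * (\<kappa> 3 p - \<kappa> 1 p) = 0" "d_z V p * (\<kappa> 4 p - \<kappa> 1 p) = 0"
    "d_rho V p * S p = 0" "d_z V p * S p = 0"
proof -
  define x :: "real^4" where "x = (\<chi> i. if i = 3 then fst p else snd p)"
  have x: "pt x = p" "x \<in> M" using p by (simp_all add: x_def pt_def weyl_domain_def)
  note nz = G_nonzero[OF p, of 1] G_nonzero[OF p, of 2] G_nonzero[OF p, of 3] G_nonzero[OF p, of 4]
  have K_off: "K x $ i $ j = 0" if "i \<noteq> j" "{i, j} \<noteq> {1, 2}" for i j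
    using off(2)[OF x(2)] that by blast
  have K_21: "K x $ 2 $ 1 = S p" using off(1)[OF x(2)] x by auto
  have K_diag: "K x $ j $ j = \<kappa> j p * G j p" for j using diag[OF x(2)] x by simp
  have "sym2 (\<lambda>i j. \<Sum>m\<in>UNIV. raise_snd (g x) (maxwell (weyl_potential V) x) m i
      * raise_both (g x) (K x) j m) a n = 0" for a n
    using al x by (simp add: aligned_def)
  moreover have "raise_snd (g x) T m a = T $ m $ a / G a p" for T m a
    by (simp add: raise_snd_def matrix_inv_g[OF x(2)] x mult_delta_right)
  moreover have "raise_both (g x) T a b = T $ a $ b / (G a p * G b p)" for T a b
    by (simp add: raise_both_def matrix_inv_g[OF x(2)] x mult_delta_left mult_delta_right
        flip: sum_divide_distrib)
  ultimately have E: "(\<Sum>m\<in>UNIV. maxwell (weyl_potential V) x $ m $ a / G a p * (K x $ n $ m / (G n p * G m p)))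
    + (\<Sum>m\<in>UNIV. maxwell (weyl_potential V) x $ m $ n / G n p * (K x $ a $ m / (G a p * G m p))) = 0" for a n
    by (simp add: sym2_def)
  show "d_rho V p * (\<kappa> 3 p - \<kappa> 1 p) = 0"
    using E[of 1 3] nz by (simp add: maxwell_weyl[OF x(2)] x K_off K_diag sum_4 doubleton_eq_iff field_simps)
  show "d_z V p * (\<kappa> 4 p - \<kappa> 1 p) = 0"
    using E[of 1 4] nz by (simp add: maxwell_weyl[OF x(2)] x K_off K_diag sum_4 doubleton_eq_iff field_simps)
  show "d_rho V p * S p = 0"
    using E[of 2 3] nz by (simp add: maxwell_weyl[OF x(2)] x K_off K_21 sum_4 doubleton_eq_iff field_simps)
  show "d_z V p * S p = 0"
    using E[of 2 4] nz by (simp add: maxwell_weyl[OF x(2)] x K_off K_21 sum_4 doubleton_eq_iff field_simps)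
qed

end

section \<open>Killing vector fields\<close>

lemma has_derivative_vec_lambda:
  fixes f :: "'a::real_normed_vector \<Rightarrow> 'n::finite \<Rightarrow> real"
  assumes "\<And>i. ((\<lambda>x. f x i) has_derivative (\<lambda>h. f' h i)) (at a)"
  shows "((\<lambda>x. \<chi> i. f x i) has_derivative (\<lambda>h. \<chi> i. f' h i)) (at a)"
  by (subst has_derivative_componentwise_within)
    (auto simp: Basis_vec_def inner_axis intro: assms)

text \<open>A family closed under coordinate derivatives: differentiating in coordinate 2 shifts the
  phases by \<open>pi / 2\<close>, in coordinate 3 it raises the exponents. Smoothness thus follows
  by induction over all parameters.\<close>

definition trig_field ::
    "real \<Rightarrow> (4 \<Rightarrow> real) \<Rightarrow> (4 \<Rightarrow> real) \<Rightarrow> (4 \<Rightarrow> nat) \<Rightarrow> real^4 \<Rightarrow> real^4"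
  where "trig_field w C D N x = (\<chi> i. C i * cos (w * x $ 2 + D i) * inverse (x $ 3) ^ N i)"

lemma trig_component_derivative:
  assumes "x $ 3 \<noteq> 0"
  shows "((\<lambda>x::real^4. c * cos (w * x $ 2 + d) * inverse (x $ 3) ^ n) has_derivative
    (\<lambda>h. h $ 2 * (c * w * cos (w * x $ 2 + d + pi / 2) * inverse (x $ 3) ^ n)
       + h $ 3 * (- real n * c * cos (w * x $ 2 + d) * inverse (x $ 3) ^ Suc n))) (at x)"
proof -
  have "((\<lambda>x::real^4. c * cos (w * x $ 2 + d)) has_derivative
      (\<lambda>h. h $ 2 * (c * w * cos (w * x $ 2 + d + pi / 2)))) (at x)"
    by (auto intro!: derivative_eq_intros bounded_linear.has_derivative[OF bounded_linear_vec_nth]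
        simp: fun_eq_iff cos_add sin_add algebra_simps)
  moreover have "((\<lambda>x::real^4. inverse (x $ 3) ^ n) has_derivative
      (\<lambda>h. h $ 3 * (- real n * inverse (x $ 3) ^ Suc n))) (at x)"
  proof -
    have "((\<lambda>u. inverse u ^ n) has_real_derivative - real n * inverse (x $ 3) ^ Suc n) (at (x $ 3))"
      by (rule DERIV_cong[OF DERIV_power[OF DERIV_inverse[OF assms]]])
        (cases n; simp add: algebra_simps)
    from has_derivative_compose[OF bounded_linear_imp_has_derivative[OF bounded_linear_vec_nth]
        this[unfolded has_field_derivative_def]]
    show ?thesis by (simp add: mult.commute)
  qed
  ultimately show ?thesis
    by (rule has_derivative_eq_rhs[OF has_derivative_mult]) (auto simp: fun_eq_iff algebra_simps)
qed

lemma trig_field_dir_deriv: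
  assumes "x $ 3 \<noteq> 0"
  shows "trig_field w C D N differentiable (at x)"
    and "dir_deriv (axis j 1) (trig_field w C D N) x =
      trig_field w (\<lambda>i. if j = 2 then C i * w else if j = 3 then - real (N i) * C i else 0)
        (\<lambda>i. if j = 2 then D i + pi / 2 else D i) (\<lambda>i. if j = 3 then Suc (N i) else N i) x"
proof -
  have T: "(trig_field w C D N has_derivative
    (\<lambda>h. \<chi> i. h $ 2 * (C i * w * cos (w * x $ 2 + D i + pi / 2) * inverse (x $ 3) ^ N i)
       + h $ 3 * (- real (N i) * C i * cos (w * x $ 2 + D i) * inverse (x $ 3) ^ Suc (N i)))) (at x)"
    unfolding trig_field_def[abs_def]
    by (rule has_derivative_vec_lambda, rule trig_component_derivative[OF assms])
  then show "trig_field w C D N differentiable (at x)" by (auto simp: differentiable_def)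
  show "dir_deriv (axis j 1) (trig_field w C D N) x =
      trig_field w (\<lambda>i. if j = 2 then C i * w else if j = 3 then - real (N i) * C i else 0)
        (\<lambda>i. if j = 2 then D i + pi / 2 else D i) (\<lambda>i. if j = 3 then Suc (N i) else N i) x"
    unfolding dir_deriv_def frechet_derivative_at[OF T, symmetric]
    by (simp add: trig_field_def vec_eq_iff axis_def add.assoc)
qed

lemma smooth_on_trig_field:
  assumes "open S" "\<And>x. x \<in> S \<Longrightarrow> x $ 3 \<noteq> 0"
  shows "smooth_on (trig_field w C D N) S"
proof -
  have "Ck_on k (trig_field w C D N) S" for k
  proof (induction k arbitrary: C D N)
    case 0
    show ?case
      using trig_field_dir_deriv(1) assms(2)
      by (auto intro!: continuous_at_imp_continuous_on differentiable_imp_continuous_within)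
  next
    case (Suc k)
    have "Ck_on k (dir_deriv v (trig_field w C D N)) S" if v: "v \<in> Basis" for v
    proof -
      obtain j where "v = axis j 1" using v by (auto simp: Basis_vec_def)
      then show ?thesis
        using Ck_on_cong[OF assms(1) trig_field_dir_deriv(2)[symmetric] Suc.IH] assms(2) by simp
    qed
    then show ?case using trig_field_dir_deriv(1) assms(2) by simp
  qed
  then show ?thesis by (simp add: smooth_on_def)
qed

lemma smooth_on_const: "smooth_on (\<lambda>_::'a::euclidean_space. c) S"
proof -
  have "Ck_on k (\<lambda>_::'a. c) S" for k
  proof (induction k arbitrary: c)
    case (Suc k)
    have "dir_deriv v (\<lambda>_. c) = (\<lambda>_. 0)" for v :: 'a
      by (simp add: fun_eq_iff dir_deriv_def)
    then show ?case using Suc by simp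
  qed simp
  then show ?thesis by (simp add: smooth_on_def)
qed

text \<open>With \<open>\<mu>\<close> constant and \<open>\<lambda>\<close> independent of \<open>\<rho>\<close>, the surfaces of constant \<open>t\<close> and \<open>z\<close> are
  flat cones \<open>m\<^sup>2 d\<rho>\<^sup>2 + \<rho>\<^sup>2 d\<phi>\<^sup>2\<close> with \<open>m = e\<^sup>\<mu>\<close>; these are the unit translations in the direction
  \<open>- \<delta>\<close>, written in the developing angle \<open>\<phi> / m\<close>.\<close>

definition cone_translation :: "real \<Rightarrow> real \<Rightarrow> real^4 \<Rightarrow> real^4"
  where "cone_translation m \<delta> = trig_field (1 / m) (\<lambda>i. if i = 2 then 1 else if i = 3 then 1 / m else 0)
    (\<lambda>i. if i = 2 then \<delta> + pi / 2 else \<delta>) (\<lambda>i. if i = 2 then 1 else 0)"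

lemma cone_translation_component:
  "cone_translation m \<delta> y $ i =
    (if i = 2 then - sin (y $ 2 / m + \<delta>) / y $ 3 else if i = 3 then cos (y $ 2 / m + \<delta>) / m else 0)"
proof -
  have "cos (t + (\<delta> + pi / 2)) = - sin (t + \<delta>)" for t
    using cos_add[of "t + \<delta>" "pi / 2"] by (simp add: add.assoc)
  then show ?thesis by (simp add: cone_translation_def trig_field_def inverse_eq_divide)
qed

lemma cone_translation_derivative:
  assumes "x $ 3 \<noteq> 0"
  shows "((\<lambda>y. cone_translation m \<delta> y $ i) has_derivative (\<lambda>h.
    if i = 2 then - h $ 2 * cos (x $ 2 / m + \<delta>) / m / x $ 3 + h $ 3 * sin (x $ 2 / m + \<delta>) / (x $ 3)\<^sup>2
    else if i = 3 then - h $ 2 * sin (x $ 2 / m + \<delta>) / m\<^sup>2 else 0)) (at x)"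
proof -
  have c: "cos (t + (\<delta> + pi / 2)) = - sin (t + \<delta>)" "cos (t + \<delta> + pi / 2) = - sin (t + \<delta>)"
    "cos (t + (\<delta> + pi / 2) + pi / 2) = - cos (t + \<delta>)" for t
    using cos_add[of "t + \<delta>" "pi / 2"] cos_add[of "t + \<delta>" pi] by (simp_all add: add.assoc)
  show ?thesis
    unfolding cone_translation_def trig_field_def vec_lambda_beta
    by (rule has_derivative_eq_rhs[OF trig_component_derivative[OF assms]], rule ext)
      (simp add: c, use assms in \<open>simp add: power2_eq_square field_simps\<close>)
qed

section \<open>Killing fields of the Weyl metric and criteria for reducibility\<close>

context weyl begin

text \<open>For a diagonal metric the component (a, a) is \<open>G a\<close> times the expression in
  \<open>diag\<close>; in the mixed components the Christoffel terms cancel the derivatives of the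
  metric entries.\<close>

lemma killing_vectorI:
  assumes "smooth_on X M"
    and diff: "\<And>x i. x \<in> M \<Longrightarrow> (\<lambda>y. X y $ i) differentiable (at x)"
    and diag: "\<And>x a. x \<in> M \<Longrightarrow> pd a (\<lambda>y. X y $ a) x + (\<Sum>s\<in>UNIV. X x $ s * L a s (pt x)) = 0"
    and off: "\<And>x a b. x \<in> M \<Longrightarrow> a \<noteq> b \<Longrightarrow>
      G a (pt x) * pd b (\<lambda>y. X y $ a) x + G b (pt x) * pd a (\<lambda>y. X y $ b) x = 0"
  shows "killing_vector g M X"
  unfolding killing_vector_def
proof (intro conjI ballI allI)
  fix x a b assume x: "x \<in> M"
  then have p: "pt x \<in> U" by (simp add: pt_in)
  have lower: "lower g X = (\<lambda>y. \<chi> i. G i (pt y) * X y $ i)"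
    by (simp add: fun_eq_iff lower_def weyl_metric_diag matrix_vector_mult_def vec_eq_iff mult_delta_left)
  have dlower: "pd b (\<lambda>y. lower g X y $ a) x =
      2 * L a b (pt x) * G a (pt x) * X x $ a + G a (pt x) * pd b (\<lambda>y. X y $ a) x" for a b
  proof -
    have "((\<lambda>y. X y $ a) has_derivative frechet_derivative (\<lambda>y. X y $ a) (at x)) (at x)"
      using diff[OF x] by (simp flip: frechet_derivative_works)
    from pd_eq[OF has_derivative_mult[OF has_grad_compose_pt[OF G_grad[OF p]] this], of b] show ?thesis
      using exhaust_4[of b] by (auto simp: lower pd_def dir_deriv_def axis_def L_zero)
  qed
  have contract: "(\<Sum>s\<in>UNIV. christoffel g x s a b * lower g X x $ s)
      = L b a (pt x) * G b (pt x) * X x $ b + L a b (pt x) * G a (pt x) * X x $ a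
        - (if a = b then G a (pt x) * (\<Sum>s\<in>UNIV. X x $ s * L a s (pt x)) else 0)" for a b
  proof -
    have "(if a = b then L a s (pt x) * G a (pt x) / G s (pt x) else 0) * (G s (pt x) * X x $ s)
        = (if a = b then G a (pt x) * (X x $ s * L a s (pt x)) else 0)" for s
      using G_nonzero[OF p, of s] by simp
    then show ?thesis
      by (simp add: christoffel_eq[OF x] lower distrib_right left_diff_distrib sum.distrib
          sum_subtractf mult_delta_left sum_distrib_left)
  qed
  have "sym2 (cov_deriv_covector g (lower g X) x) a b =
      (if a = b then G a (pt x) * (pd a (\<lambda>y. X y $ a) x + (\<Sum>s\<in>UNIV. X x $ s * L a s (pt x)))
       else (G a (pt x) * pd b (\<lambda>y. X y $ a) x + G b (pt x) * pd a (\<lambda>y. X y $ b) x) / 2)"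
    by (simp add: sym2_def cov_deriv_covector_def dlower contract) (simp add: algebra_simps)
  then show "sym2 (cov_deriv_covector g (lower g X) x) a b = 0"
    using diag[OF x, of a] off[OF x, of a b] by (cases "a = b") auto
qed (rule assms(1))

text \<open>The factor \<open>e\<close> admits the zero field (\<open>e = 0\<close>) without any
  symmetry; for \<open>e = 1\<close> the metric entries must not vary with coordinate
  \<open>i\<close>.\<close>

lemma killing_vector_axis:
  assumes "\<And>p a. p \<in> U \<Longrightarrow> e * L a i p = 0"
  shows "killing_vector g M (\<lambda>_. axis i e)"
proof (rule killing_vectorI[OF smooth_on_const])
  show "pd a (\<lambda>y. axis i e $ a) x + (\<Sum>s\<in>UNIV. axis i e $ s * L a s (pt x)) = 0" if "x \<in> M" for x a
  proof -
    have "axis i e $ s * L a s (pt x) = 0" for s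
      using assms[of "pt x" a] that by (simp add: axis_def pt_in)
    then have "(\<Sum>s\<in>UNIV. axis i e $ s * L a s (pt x)) = 0" by (intro sum.neutral) blast
    then show ?thesis by (simp add: pd_def dir_deriv_def)
  qed
qed (simp_all add: pd_def dir_deriv_def)

text \<open>The translations are isometries of the flat cone, and \<open>lam\<close> does not vary
  along it, so they preserve the other metric coefficients too.\<close>

lemma killing_vector_cone_translation:
  assumes "\<And>p. p \<in> U \<Longrightarrow> d_rho lam p = 0" "\<And>p. p \<in> U \<Longrightarrow> mu p = c"
  shows "killing_vector g M (cone_translation (exp c) \<delta>)"
proof (rule killing_vectorI)
  have x3: "x $ 3 \<noteq> 0" if "x \<in> M" for x
    using fst_pos[of "pt x"] that by (simp add: pt_in) (simp add: pt_def)
  then show "smooth_on (cone_translation (exp c) \<delta>) M"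
    unfolding cone_translation_def by (intro smooth_on_trig_field open_M) auto
  note D = cone_translation_derivative[OF x3]
  show "(\<lambda>y. cone_translation (exp c) \<delta> y $ i) differentiable (at x)" if "x \<in> M" for x i
    by (rule differentiableI[OF D[OF that]])
  have mu: "d_rho mu p = 0" if "p \<in> U" for p
    by (rule has_gradD(1)[OF has_grad_cong[OF has_grad_const[of c] open_U that]]) (simp add: assms)
  show "pd a (\<lambda>y. cone_translation (exp c) \<delta> y $ a) x
      + (\<Sum>s\<in>UNIV. cone_translation (exp c) \<delta> x $ s * L a s (pt x)) = 0" if x: "x \<in> M" for x a
    unfolding pd_eq[OF D[OF x]]
    using assms(1)[of "pt x"] mu[of "pt x"] x exhaust_4[of a]
    by (auto simp: axis_def pt_in sum_4 L_zero cone_translation_component weyl_dlog_def)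
      (simp add: pt_def)
  show "G a (pt x) * pd b (\<lambda>y. cone_translation (exp c) \<delta> y $ a) x
      + G b (pt x) * pd a (\<lambda>y. cone_translation (exp c) \<delta> y $ b) x = 0"
    if x: "x \<in> M" and ab: "a \<noteq> b" for x a b
  proof -
    \<comment> \<open>The (2, 3) component is proportional to
      \<open>G 2 / (x $ 3)\<^sup>2 - G 3 / (exp c)\<^sup>2\<close>; the relation obtained here makes
      it vanish.\<close>
    have "exp (2 * c) = (exp c)\<^sup>2" by (simp add: exp_double)
    moreover have "fst (pt x) = x $ 3" by (simp add: pt_def)
    ultimately have G: "G 2 (pt x) * (exp c)\<^sup>2 = G 3 (pt x) * (x $ 3)\<^sup>2"
      using assms(2)[of "pt x"] x by (simp add: weyl_diag_def pt_in)
    show ?thesis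
      unfolding pd_eq[OF D[OF x]]
      using exhaust_4[of a] exhaust_4[of b] ab x3[OF x] G
      by (elim disjE) (simp_all add: axis_def field_simps)
  qed
qed

lemma lower_g: "lower g X x $ i = G i (pt x) * X x $ i"
  by (simp add: lower_def weyl_metric_diag matrix_vector_mult_def mult_delta_left)

lemma reducible_by_coordinate_fields:
  assumes diag: "\<And>x i. x \<in> M \<Longrightarrow> K x $ i $ i = \<kappa> i (pt x) * G i (pt x)"
    and off: "\<And>x i j. x \<in> M \<Longrightarrow> i \<noteq> j \<Longrightarrow> K x $ i $ j = 0"
    and \<kappa>: "\<And>p i. p \<in> U \<Longrightarrow> \<kappa> i p = c0 + c i * G i p" and c3: "c 3 = 0"
    and c4: "c 4 = 0 \<or> (\<forall>p\<in>U. d_z lam p = 0 \<and> d_z mu p = 0)"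
  shows "reducible g M K"
proof -
  \<comment> \<open>A vanishing coefficient is paired with the zero field, so that
    \<open>X 2\<close> is Killing even where the z translation is no symmetry.\<close>
  define e where "e i = (if c i = 0 then 0 else 1 :: real)" for i
  define X :: "nat \<Rightarrow> real^4 \<Rightarrow> real^4" where "X k = (\<lambda>_. if k = 0 then axis 1 (e 1) else if k = 1 then axis 2 (e 2) else axis 4 (e 4))" for k
  define d where "d k = (if k = 0 then c 1 else if k = 1 then c 2 else c 4)" for k :: nat
  have "killing_vector g M (\<lambda>_. axis 4 (e 4))"
    using c4 by (intro killing_vector_axis) (auto simp: e_def weyl_dlog_def)
  moreover have "killing_vector g M (\<lambda>_. axis 1 (e 1))" "killing_vector g M (\<lambda>_. axis 2 (e 2))"
    by (intro killing_vector_axis; simp add: L_zero)+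
  ultimately have kX: "killing_vector g M (X k)" for k
    by (simp add: X_def)
  have e: "c i * e i = c i" for i by (simp add: e_def)
  have "K x $ m $ n = c0 * g x $ m $ n
      + (\<Sum>k<3. d k * sym2 (\<lambda>i j. lower g (X k) x $ i * lower g (X k) x $ j) m n)" if x: "x \<in> M" for x m n
  proof -
    have S: "(\<Sum>k<3. d k * sym2 (\<lambda>i j. lower g (X k) x $ i * lower g (X k) x $ j) m n)
      = (if m = n then c m * (G m (pt x))\<^sup>2 else 0)"
      using exhaust_4[of m] exhaust_4[of n] e c3
      by (elim disjE; simp add: numeral_3_eq_3 d_def X_def lower_g sym2_def axis_def e_def power2_eq_square)
    show ?thesis
    proof (cases "m = n")
      case True
      then show ?thesis
        using diag[OF x, of n] \<kappa>[of "pt x" n] x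
        unfolding S by (simp add: weyl_metric_diag pt_in power2_eq_square algebra_simps)
    next
      case False
      then show ?thesis
        using off[OF x False] unfolding S by (simp add: weyl_metric_diag)
    qed
  qed
  with kX show ?thesis
    unfolding reducible_def by (intro exI[of _ c0] exI[of _ 3] exI[of _ d] exI[of _ X]) simp
qed

text \<open>The squares of two orthogonal unit translations add up to the inverse metric of the
  cone. With weight \<open>c * m\<^sup>2\<close> they supply the term \<open>c * G 3\<close> of both
  \<open>\<kappa> 2\<close> and \<open>\<kappa> 3\<close>; the rotation supplies
  \<open>c' * G 2\<close>.\<close>

lemma reducible_by_cone_translations:
  assumes diag: "\<And>x i. x \<in> M \<Longrightarrow> K x $ i $ i = \<kappa> i (pt x) * G i (pt x)"
    and off: "\<And>x i j. x \<in> M \<Longrightarrow> i \<noteq> j \<Longrightarrow> K x $ i $ j = 0"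
    and \<kappa>: "\<And>p. p \<in> U \<Longrightarrow> \<kappa> 1 p = c0" "\<And>p. p \<in> U \<Longrightarrow> \<kappa> 4 p = c0"
      "\<And>p. p \<in> U \<Longrightarrow> \<kappa> 3 p = c0 + c * G 3 p"
      "\<And>p. p \<in> U \<Longrightarrow> \<kappa> 2 p = c0 + c * G 3 p + c' * G 2 p"
    and lam: "\<And>p. p \<in> U \<Longrightarrow> d_rho lam p = 0" and mu: "\<And>p. p \<in> U \<Longrightarrow> mu p = b"
  shows "reducible g M K"
proof -
  define m where "m = exp b"
  \<comment> \<open>The phases 0 and \<open>pi / 2\<close> select orthogonal directions of
    translation.\<close>
  define X :: "nat \<Rightarrow> real^4 \<Rightarrow> real^4" where
    "X k = (if k = 0 then (\<lambda>_. axis 2 1) else cone_translation m (if k = 1 then 0 else pi / 2))" for k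
  define d where "d k = (if k = 0 then c' else c * m\<^sup>2)" for k :: nat
  have "killing_vector g M (\<lambda>_. axis 2 1)"
    by (intro killing_vector_axis; simp add: L_zero)
  then have kX: "killing_vector g M (X k)" for k
    using killing_vector_cone_translation[OF lam mu] by (simp add: X_def m_def)
  have "K x $ i $ j = c0 * g x $ i $ j
      + (\<Sum>k<3. d k * sym2 (\<lambda>i j. lower g (X k) x $ i * lower g (X k) x $ j) i j)" if x: "x \<in> M" for x i j
  proof -
    have p: "pt x \<in> U" using x by (simp add: pt_in)
    have r: "x $ 3 \<noteq> 0" using fst_pos[OF p] by (simp add: pt_def)
    have m0: "m \<noteq> 0" by (simp add: m_def)
    have "exp (2 * b) = m\<^sup>2" by (simp add: m_def exp_double)
    moreover have "fst (pt x) = x $ 3" by (simp add: pt_def)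
    ultimately have G23: "G 2 (pt x) * m\<^sup>2 = G 3 (pt x) * (x $ 3)\<^sup>2"
      using mu[OF p] by (simp add: weyl_diag_def)
    have S: "(\<Sum>k<3. d k * sym2 (\<lambda>i j. lower g (X k) x $ i * lower g (X k) x $ j) i j)
      = (if i = j then (if i = 3 then c * (G 3 (pt x))\<^sup>2
          else if i = 2 then c' * (G 2 (pt x))\<^sup>2 + c * m\<^sup>2 * (G 2 (pt x) / x $ 3)\<^sup>2 else 0) else 0)"
    proof -
      define s cs u v where "s = sin (x $ 2 / m)" and "cs = cos (x $ 2 / m)"
        and "u = G 2 (pt x) / x $ 3" and "v = G 3 (pt x) / m"
      have rot: "sin (x $ 2 / m + pi / 2) = cs" "cos (x $ 2 / m + pi / 2) = - s"
        using sin_add[of "x $ 2 / m" "pi / 2"] cos_add[of "x $ 2 / m" "pi / 2"]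
        by (simp_all add: s_def cs_def)
      have sc: "s * s + cs * cs = 1"
        using sin_cos_squared_add[of "x $ 2 / m"] by (simp add: s_def cs_def power2_eq_square)
      have X0: "lower g (X 0) x $ i = (if i = 2 then G 2 (pt x) else 0)" for i
        by (simp add: X_def lower_g axis_def)
      have X1: "lower g (X 1) x $ i = (if i = 2 then - (u * s) else if i = 3 then v * cs else 0)" for i
        by (simp add: X_def lower_g cone_translation_component u_def v_def flip: s_def cs_def)
      have X2: "lower g (X 2) x $ i = (if i = 2 then - (u * cs) else if i = 3 then - (v * s) else 0)" for i
        by (simp add: X_def lower_g cone_translation_component u_def v_def rot)
      \<comment> \<open>This settles the diagonal entries; the mixed products of \<open>u\<close>
        and \<open>v\<close> have opposite signs and cancel.\<close>
      have pyth: "w * s * (w * s) + w * cs * (w * cs) = w\<^sup>2" for w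
      proof -
        have "w * s * (w * s) + w * cs * (w * cs) = w\<^sup>2 * (s * s + cs * cs)"
          by (simp add: power2_eq_square algebra_simps)
        then show ?thesis by (simp add: sc)
      qed
      have "(\<Sum>k<3. d k * sym2 (\<lambda>i j. lower g (X k) x $ i * lower g (X k) x $ j) i j)
          = c' * (lower g (X 0) x $ i * lower g (X 0) x $ j)
            + c * m\<^sup>2 * (lower g (X 1) x $ i * lower g (X 1) x $ j + lower g (X 2) x $ i * lower g (X 2) x $ j)"
        by (simp add: numeral_3_eq_3 numeral_2_eq_2 d_def sym2_def distrib_left mult.commute)
      also have "lower g (X 1) x $ i * lower g (X 1) x $ j + lower g (X 2) x $ i * lower g (X 2) x $ j
          = (if i = j then (if i = 2 then u\<^sup>2 else if i = 3 then v\<^sup>2 else 0) else 0)"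
        using pyth[of u] pyth[of v] unfolding X1 X2 by (auto simp: add.commute)
      finally show ?thesis
        unfolding X0 using m0 by (auto simp: u_def v_def power2_eq_square)
    qed
    \<comment> \<open>The (2, 2) entry of the translations is thereby the share
      \<open>c * G 3\<close> of \<open>\<kappa> 2\<close>, multiplied by \<open>G 2\<close>.\<close>
    have "m\<^sup>2 * (G 2 (pt x) / x $ 3)\<^sup>2 = G 2 (pt x) * (G 2 (pt x) * m\<^sup>2) / (x $ 3)\<^sup>2"
      by (simp add: power2_eq_square)
    also have "\<dots> = G 2 (pt x) * G 3 (pt x)" using r by (simp add: G23)
    finally have G2: "c * m\<^sup>2 * (G 2 (pt x) / x $ 3)\<^sup>2 = c * G 2 (pt x) * G 3 (pt x)" by simp
    show ?thesis
    proof (cases "i = j")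
      case True
      then show ?thesis
        using diag[OF x, of j] \<kappa>[OF p] exhaust_4[of j] unfolding S G2
        by (elim disjE) (simp_all add: weyl_metric_diag pt_in power2_eq_square algebra_simps)
    next
      case False
      then show ?thesis
        using off[OF x False] unfolding S by (simp add: weyl_metric_diag)
    qed
  qed
  with kX show ?thesis
    unfolding reducible_def by (intro exI[of _ c0] exI[of _ 3] exI[of _ d] exI[of _ X]) simp
qed

text \<open>By \<open>G_grad\<close> the entry \<open>G i\<close> obeys the same linear equation, so
  the quotient has zero gradient.\<close>

lemma ratio_constant:
  assumes "\<And>p. p \<in> U \<Longrightarrow> has_grad f (f p * (2 * L i 3 p)) (f p * (2 * L i 4 p)) p"
  shows "\<exists>c. \<forall>p\<in>U. f p = c * G i p"
proof -
  have "\<exists>c. \<forall>p\<in>U. f p / G i p = c"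
  proof (rule has_grad_zero_imp_constant[OF open_U connected_U])
    fix p assume p: "p \<in> U"
    show "has_grad (\<lambda>p. f p / G i p) 0 0 p"
      by (rule has_grad_eq[OF has_grad_divide[OF assms[OF p] G_grad[OF p] G_nonzero[OF p]]])
        (simp_all add: algebra_simps)
  qed
  then show ?thesis using G_nonzero by (metis nonzero_divide_eq_eq)
qed

end

section \<open>Integrating the Killing equation\<close>

text \<open>The device for differentiating an identity that holds on an open set.\<close>

lemma has_grad_eq_on_open:
  assumes "open N" "p \<in> N" "\<And>x. x \<in> N \<Longrightarrow> f x = h x" "has_grad f a b p" "has_grad h c d p"
  shows "a = c" "b = d"
  using has_grad_unique[OF has_grad_cong[OF assms(4,1-3)] assms(5)] by blast+

lemma open_nonzero_set:
  fixes f :: "real \<times> real \<Rightarrow> real"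
  assumes "open U" "continuous_on U f"
  shows "open {p \<in> U. f p \<noteq> 0}"
  using continuous_open_preimage[OF assms(2,1), of "- {0}"]
  by (simp add: vimage_def Int_def open_Compl)

section \<open>Consequences of the field equations\<close>

context weyl begin

lemma continuous_fst_inverse: "continuous_on U (\<lambda>p. c / fst p)"
  using fst_pos by (intro continuous_intros) force+

lemmas continuous_d_rho = smooth_on_imp_continuous_on[OF smooth_on_d_rho]
  and continuous_d_z = smooth_on_imp_continuous_on[OF smooth_on_d_z]

lemma field_equations:
  assumes "p \<in> U"
  shows "d_rho (d_rho lam) p + d_rho lam p / fst p + d_z (d_z lam) p
      = exp (- 2 * lam p) * ((d_rho V p)\<^sup>2 + (d_z V p)\<^sup>2)"
    and "d_rho (d_rho V) p + d_rho V p / fst p + d_z (d_z V) p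
      = 2 * (d_rho lam p * d_rho V p + d_z lam p * d_z V p)"
    and "d_rho mu p = fst p * ((d_rho lam p)\<^sup>2 - (d_z lam p)\<^sup>2)
      - fst p * exp (- 2 * lam p) * ((d_rho V p)\<^sup>2 - (d_z V p)\<^sup>2)"
    and "d_z mu p = 2 * fst p * (d_rho lam p * d_z lam p - exp (- 2 * lam p) * d_rho V p * d_z V p)"
  using electrovac assms unfolding weyl_electrovac_def by blast+

lemma mixed_partials: "smooth_on f U \<Longrightarrow> p \<in> U \<Longrightarrow> d_rho (d_z f) p = d_z (d_rho f) p"
  by (rule mixed_partials_commute[OF open_U])

lemma grad_zero_on:
  assumes "\<And>p. p \<in> U \<Longrightarrow> f p = 0" "p \<in> U"
  shows "d_rho f p = 0" "d_z f p = 0"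
  using has_gradD[OF has_grad_cong[OF has_grad_const open_U assms(2)], of 0 f] assms(1) by auto

text \<open>Where both partial derivatives of \<open>V\<close> vanish, the second derivatives of their product
  \<open>0\<close> and the Maxwell equation force the Hessian of \<open>V\<close> to vanish; so each partial derivative is
  everywhere proportional to its own gradient.\<close>

lemma one_dimensional_potential:
  assumes fg: "\<And>p. p \<in> U \<Longrightarrow> d_rho V p * d_z V p = 0" and nonconst: "\<not> V constant_on U"
  shows "(\<forall>p\<in>U. d_z V p = 0 \<and> d_rho V p \<noteq> 0) \<or> (\<forall>p\<in>U. d_rho V p = 0 \<and> d_z V p \<noteq> 0)"
proof -
  let ?f = "d_rho V" and ?g = "d_z V"
  have sf: "smooth_on ?f U" and sg: "smooth_on ?g U"
    using smooth by (simp_all add: smooth_on_d_rho smooth_on_d_z)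
  note s2 = smooth_on_d_rho[OF sf] smooth_on_d_z[OF sf] smooth_on_d_rho[OF sg] smooth_on_d_z[OF sg]
  have grad: "has_grad ?f (d_rho ?f p) (d_z ?f p) p" "has_grad ?g (d_rho ?g p) (d_z ?g p) p" if "p \<in> U" for p
    using that sf sg by (simp_all add: has_grad_smooth)
  have P: "d_rho ?f p * ?g p + ?f p * d_rho ?g p = 0" "d_z ?f p * ?g p + ?f p * d_z ?g p = 0"
    if p: "p \<in> U" for p
    using has_grad_eq_on_open[OF open_U p fg has_grad_mult[OF grad[OF p]] has_grad_const] by auto
  have hess: "d_rho ?f p = ?f p * (2 * d_rho lam p - 1 / fst p)" "d_z ?f p = 0"
    "d_rho ?g p = 0" "d_z ?g p = ?g p * (2 * d_z lam p)" if p: "p \<in> U" for p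
  proof -
    note E = field_equations(2)[OF p] and mx = mixed_partials[OF smooth(3) p]
    consider "?f p \<noteq> 0" | "?g p \<noteq> 0" | "?f p = 0" "?g p = 0" by blast
    then have "d_rho ?f p = ?f p * (2 * d_rho lam p - 1 / fst p) \<and> d_z ?f p = 0
      \<and> d_z ?g p = ?g p * (2 * d_z lam p)"
    proof cases
      case 1
      then have "?g p = 0" using fg[OF p] by simp
      with 1 P[OF p] E mx show ?thesis by (simp add: algebra_simps)
    next
      case 2
      then have "?f p = 0" using fg[OF p] by simp
      with 2 P[OF p] E mx show ?thesis by (simp add: algebra_simps)
    next
      case 3
      \<comment> \<open>The first identity of \<open>P\<close> is differentiated once more. With the
        Maxwell equation and equal mixed partials, \<open>x = d_rho ?f p\<close> and
        \<open>y = d_z ?f p\<close> satisfy \<open>x * y = 0\<close> and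
        \<open>x\<^sup>2 = y\<^sup>2\<close>.\<close>
      have "d_rho ?f p * d_rho ?g p = 0" "d_rho ?f p * d_z ?g p + d_z ?f p * d_rho ?g p = 0"
        using has_grad_eq_on_open[OF open_U p P(1) has_grad_add[OF
            has_grad_mult[OF has_grad_smooth[OF s2(1) p] grad(2)[OF p]]
            has_grad_mult[OF grad(1)[OF p] has_grad_smooth[OF s2(3) p]]] has_grad_const] 3
        by auto
      moreover have "d_z ?g p = - d_rho ?f p" using E 3 by simp
      ultimately have "d_rho ?f p = 0 \<or> d_z ?f p = 0" "(d_rho ?f p)\<^sup>2 = (d_z ?f p)\<^sup>2"
        using mx by (auto simp: power2_eq_square)
      then show ?thesis using 3 \<open>d_z ?g p = - d_rho ?f p\<close> by auto
    qed
    then show "d_rho ?f p = ?f p * (2 * d_rho lam p - 1 / fst p)" "d_z ?f p = 0"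
      "d_rho ?g p = 0" "d_z ?g p = ?g p * (2 * d_z lam p)" using mx by auto
  qed
  have f: "?f x = 0" if "p \<in> U" "?f p = 0" "x \<in> U" for p x
  proof (rule proportional_grad_vanishes[where f = ?f, OF open_U connected_U _ _ _ that])
    show "has_grad ?f (?f p * (2 * d_rho lam p - 1 / fst p)) (?f p * 0) p" if "p \<in> U" for p
      using grad(1)[OF that] hess[OF that] by simp
    show "continuous_on U (\<lambda>p. 2 * d_rho lam p - 1 / fst p)"
      by (intro continuous_intros continuous_d_rho smooth continuous_fst_inverse)
  qed simp
  have g: "?g x = 0" if "p \<in> U" "?g p = 0" "x \<in> U" for p x
  proof (rule proportional_grad_vanishes[where f = ?g, OF open_U connected_U _ _ _ that])
    show "has_grad ?g (?g p * 0) (?g p * (2 * d_z lam p)) p" if "p \<in> U" for p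
      using grad(2)[OF that] hess[OF that] by simp
    show "continuous_on U (\<lambda>p. 2 * d_z lam p)"
      by (intro continuous_intros continuous_d_z smooth)
  qed simp
  have "\<exists>p\<in>U. ?f p \<noteq> 0 \<or> ?g p \<noteq> 0"
  proof (rule ccontr)
    assume "\<not> ?thesis"
    then have "\<exists>c. \<forall>p\<in>U. V p = c"
      using V_grad by (intro has_grad_zero_imp_constant[OF open_U connected_U]) force
    then show False using nonconst by (simp add: constant_on_def)
  qed
  then show ?thesis using f g fg by (metis mult_eq_0_iff)
qed

end

text \<open>Only the eigenvalues and their first-order system are kept from the Killing tensor,
  which separates its integration from the tensor calculus.\<close>

locale weyl_killing = weyl +
  fixes \<kappa> :: "4 \<Rightarrow> real \<times> real \<Rightarrow> real"
  assumes smooth_\<kappa>: "smooth_on (\<kappa> i) U"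
    and \<kappa>_rho: "p \<in> U \<Longrightarrow> d_rho (\<kappa> i) p = 2 * L i 3 p * (\<kappa> i p - \<kappa> 3 p)"
    and \<kappa>_z: "p \<in> U \<Longrightarrow> d_z (\<kappa> i) p = 2 * L i 4 p * (\<kappa> i p - \<kappa> 4 p)"
begin

lemma \<kappa>_grad: "p \<in> U \<Longrightarrow>
    has_grad (\<kappa> i) (2 * L i 3 p * (\<kappa> i p - \<kappa> 3 p)) (2 * L i 4 p * (\<kappa> i p - \<kappa> 4 p)) p"
  using has_grad_smooth[OF smooth_\<kappa>, of p i] by (simp add: \<kappa>_rho \<kappa>_z)

definition coordinate_normal_form :: bool
  where "coordinate_normal_form \<longleftrightarrow> (\<exists>c0 c. c 3 = 0 \<and>
    (c 4 = 0 \<or> (\<forall>p\<in>U. d_z lam p = 0 \<and> d_z mu p = 0)) \<and>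
    (\<forall>p\<in>U. \<forall>i. \<kappa> i p = c0 + c i * G i p))"

definition cone_normal_form :: bool
  where "cone_normal_form \<longleftrightarrow> (\<exists>c0 c c' b. \<forall>p\<in>U. d_rho lam p = 0 \<and> mu p = b \<and>
    \<kappa> 1 p = c0 \<and> \<kappa> 4 p = c0 \<and> \<kappa> 3 p = c0 + c * G 3 p \<and> \<kappa> 2 p = c0 + c * G 3 p + c' * G 2 p)"

text \<open>In both cases \<open>L i 4 p * (\<kappa> 3 p - \<kappa> 4 p) = 0\<close>, so
  \<open>\<kappa> 3\<close> may replace \<open>\<kappa> 4\<close> in the system. Then
  \<open>\<kappa> 3\<close> is a constant \<open>c0\<close>, and \<open>\<kappa> i - c0\<close> is a
  multiple of \<open>G i\<close>.\<close>

lemma coordinate_normal_formI: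
  assumes "(\<forall>p\<in>U. \<kappa> 3 p = \<kappa> 4 p) \<or> (\<forall>p\<in>U. d_z lam p = 0 \<and> d_z mu p = 0)"
  shows coordinate_normal_form
proof -
  have z: "L i 4 p * (\<kappa> 3 p - \<kappa> 4 p) = 0" if "p \<in> U" for i p
    using assms that by (auto simp: weyl_dlog_def)
  have "\<exists>c0. \<forall>p\<in>U. \<kappa> 3 p = c0"
    by (rule has_grad_zero_imp_constant[OF open_U connected_U])
      (rule has_grad_eq[OF \<kappa>_grad], use z in auto)
  then obtain c0 where c0: "\<And>p. p \<in> U \<Longrightarrow> \<kappa> 3 p = c0" by blast
  have "\<exists>c. \<forall>p\<in>U. \<kappa> i p - c0 = c * G i p" for i
  proof (rule ratio_constant)
    fix p assume p: "p \<in> U"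
    have "L i 4 p * (\<kappa> i p - \<kappa> 4 p) = L i 4 p * (\<kappa> i p - c0)"
      using z[OF p, of i] c0[OF p] by (simp add: algebra_simps)
    then show "has_grad (\<lambda>p. \<kappa> i p - c0) ((\<kappa> i p - c0) * (2 * L i 3 p)) ((\<kappa> i p - c0) * (2 * L i 4 p)) p"
      by (intro has_grad_eq[OF has_grad_diff[OF \<kappa>_grad[OF p] has_grad_const]])
        (simp_all add: c0[OF p] mult.commute mult.left_commute)
  qed
  then obtain c where c: "\<And>i p. p \<in> U \<Longrightarrow> \<kappa> i p - c0 = c i * G i p" by metis
  \<comment> \<open>The changes keep the formula valid: \<open>\<kappa> 3\<close> equals
    \<open>c0\<close>, and so does \<open>\<kappa> 4\<close> where its coefficient is
    cleared.\<close>
  define c' where "c' = c(3 := 0, 4 := if \<forall>p\<in>U. \<kappa> 3 p = \<kappa> 4 p then 0 else c 4)"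
  have "\<kappa> i p = c0 + c' i * G i p" if "p \<in> U" for p i
    using c[OF that, of i] c0[OF that] that by (auto simp: c'_def)
  moreover have "c' 3 = 0" "c' 4 = 0 \<or> (\<forall>p\<in>U. d_z lam p = 0 \<and> d_z mu p = 0)"
    using assms by (auto simp: c'_def)
  ultimately show ?thesis unfolding coordinate_normal_form_def by blast
qed

text \<open>Since \<open>L 4 3\<close> vanishes, \<open>\<kappa> 4\<close> is constant, and the
  system integrates successively for \<open>\<kappa> 3\<close> and
  \<open>\<kappa> 2\<close>.\<close>

lemma cone_normal_formI:
  assumes "\<And>p. p \<in> U \<Longrightarrow> d_rho lam p = 0 \<and> d_rho mu p = 0 \<and> d_z mu p = 0 \<and> \<kappa> 1 p = \<kappa> 4 p"
  shows cone_normal_form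
proof -
  have "\<exists>b. \<forall>p\<in>U. mu p = b"
    by (rule has_grad_zero_imp_constant[OF open_U connected_U])
      (rule has_grad_eq[OF mu_grad], use assms in auto)
  then obtain b where b: "\<And>p. p \<in> U \<Longrightarrow> mu p = b" by blast
  have "\<exists>c0. \<forall>p\<in>U. \<kappa> 4 p = c0"
    by (rule has_grad_zero_imp_constant[OF open_U connected_U])
      (rule has_grad_eq[OF \<kappa>_grad], use assms in \<open>auto simp: weyl_dlog_def\<close>)
  then obtain c0 where c0: "\<And>p. p \<in> U \<Longrightarrow> \<kappa> 4 p = c0" by blast
  have "\<exists>c. \<forall>p\<in>U. \<kappa> 3 p - c0 = c * G 3 p"
  proof (rule ratio_constant)
    fix p assume p: "p \<in> U"
    show "has_grad (\<lambda>p. \<kappa> 3 p - c0) ((\<kappa> 3 p - c0) * (2 * L 3 3 p)) ((\<kappa> 3 p - c0) * (2 * L 3 4 p)) p"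
      by (rule has_grad_eq[OF has_grad_diff[OF \<kappa>_grad[OF p] has_grad_const]])
        (use assms[OF p] c0[OF p] in \<open>simp_all add: weyl_dlog_def\<close>)
  qed
  then obtain c where c: "\<And>p. p \<in> U \<Longrightarrow> \<kappa> 3 p - c0 = c * G 3 p" by blast
  \<comment> \<open>With \<open>mu\<close> constant, \<open>L 2 4 = L 3 4\<close>, so
    \<open>\<kappa> 4\<close> drops out of the z derivative of the difference.\<close>
  have "\<exists>c. \<forall>p\<in>U. \<kappa> 2 p - \<kappa> 3 p = c * G 2 p"
  proof (rule ratio_constant)
    fix p assume p: "p \<in> U"
    show "has_grad (\<lambda>p. \<kappa> 2 p - \<kappa> 3 p) ((\<kappa> 2 p - \<kappa> 3 p) * (2 * L 2 3 p)) ((\<kappa> 2 p - \<kappa> 3 p) * (2 * L 2 4 p)) p"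
      by (rule has_grad_eq[OF has_grad_diff[OF \<kappa>_grad[OF p] \<kappa>_grad[OF p]]])
        (use assms[OF p] c0[OF p] in \<open>simp_all add: weyl_dlog_def algebra_simps\<close>)
  qed
  then obtain c' where c': "\<And>p. p \<in> U \<Longrightarrow> \<kappa> 2 p - \<kappa> 3 p = c' * G 2 p" by blast
  have "\<kappa> 1 p = c0" "\<kappa> 3 p = c0 + c * G 3 p" "\<kappa> 2 p = c0 + c * G 3 p + c' * G 2 p" if "p \<in> U" for p
    using assms[OF that] c0[OF that] c[OF that] c'[OF that] by linarith+
  then show ?thesis
    unfolding cone_normal_form_def using assms b c0
    by (intro exI[of _ c0] exI[of _ c] exI[of _ c'] exI[of _ b] ballI conjI) simp_all
qed

text \<open>Comparing the z derivatives of \<open>\<kappa> 1\<close> and \<open>\<kappa> 3\<close>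
  gives \<open>d_z mu = 2 * d_z lam\<close>; the field equation for \<open>d_z mu\<close> then
  leaves \<open>d_z lam = 0\<close> or \<open>d_rho lam = 1 / fst p\<close>. The second alternative
  with \<open>d_z lam \<noteq> 0\<close> is refuted by computing \<open>d_rho mu\<close> in two
  ways.\<close>

lemma normal_form_rho:
  assumes V: "\<And>p. p \<in> U \<Longrightarrow> d_z V p = 0" "\<And>p. p \<in> U \<Longrightarrow> \<kappa> 1 p = \<kappa> 3 p"
    and D: "\<And>p. p \<in> U \<Longrightarrow> \<kappa> 3 p \<noteq> \<kappa> 4 p"
  shows coordinate_normal_form
proof -
  have mu: "d_z mu p = 2 * d_z lam p" if p: "p \<in> U" for p
    using has_grad_eq_on_open(2)[OF open_U p V(2) \<kappa>_grad[OF p] \<kappa>_grad[OF p]] V(2)[OF p] D[OF p]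
    by (simp add: weyl_dlog_def)
  have lam: "d_z lam p = 0 \<or> fst p * d_rho lam p = 1" if p: "p \<in> U" for p
    using field_equations(4)[OF p] mu[OF p] V(1)[OF p] by auto
  have "d_z lam p = 0" if p: "p \<in> U" for p
  proof (rule ccontr)
    assume nz: "d_z lam p \<noteq> 0"
    let ?N = "{q \<in> U. d_z lam q \<noteq> 0}"
    have N: "open ?N" by (intro open_nonzero_set open_U continuous_d_z smooth)
    have r: "fst p > 0" by (rule fst_pos[OF p])
    have lr: "d_rho lam p = 1 / fst p" using lam[OF p] nz r by (simp add: field_simps)
    have "fst p * d_z (d_rho lam) p = 0"
      using has_grad_eq_on_open(2)[OF N _ _ has_grad_mult[OF has_grad_fst
            has_grad_smooth[OF smooth_on_d_rho[OF smooth(1)] p]] has_grad_const[of 1]] lam nz p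
      by force
    then have mixed: "d_rho (d_z lam) p = 0" using r mixed_partials[OF smooth(1) p] by simp
    \<comment> \<open>\<open>\<kappa> 3\<close> has no rho derivative. Expanding its mixed
      derivative leaves only a multiple of \<open>L 4 3\<close>, which must vanish and so fixes
      \<open>d_rho mu p\<close>.\<close>
    have "d_rho (d_z (\<kappa> 3)) p = 0"
      using mixed_partials[OF smooth_\<kappa> p] grad_zero_on(2)[OF _ p, of "d_rho (\<kappa> 3)"] \<kappa>_rho by simp
    moreover have "d_z (\<kappa> 3) q = 2 * d_z lam q * (\<kappa> 3 q - \<kappa> 4 q)" if "q \<in> U" for q
      using \<kappa>_z[OF that, of 3] mu[OF that] by (simp add: weyl_dlog_def)
    ultimately have "d_z lam p * (2 * L 4 3 p * (\<kappa> 4 p - \<kappa> 3 p)) = 0"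
      using has_grad_eq_on_open(1)[OF open_U p _ has_grad_smooth[OF smooth_on_d_z[OF smooth_\<kappa>] p]
        has_grad_mult[OF has_grad_mult[OF has_grad_const[of 2]
          has_grad_smooth[OF smooth_on_d_z[OF smooth(1)] p]] has_grad_diff[OF \<kappa>_grad[OF p] \<kappa>_grad[OF p]]],
        of 3 3 4] mixed
      by simp
    then have mr: "d_rho mu p = 1 / fst p" using nz D[OF p] lr by (simp add: weyl_dlog_def)
    note E = field_equations(3)[OF p, unfolded lr mr V(1)[OF p]]
    have sq: "fst p * (1 / fst p)\<^sup>2 = 1 / fst p" using r by (simp add: power2_eq_square)
    \<comment> \<open>The terms \<open>1 / fst p\<close> cancel in the field equation, leaving a sum
      of squares that must be zero.\<close>
    have "fst p * ((d_z lam p)\<^sup>2 + exp (- 2 * lam p) * (d_rho V p)\<^sup>2)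
      = fst p * (1 / fst p)\<^sup>2 - (fst p * ((1 / fst p)\<^sup>2 - (d_z lam p)\<^sup>2)
        - fst p * exp (- 2 * lam p) * ((d_rho V p)\<^sup>2 - 0\<^sup>2))"
      by (simp add: algebra_simps)
    also have "\<dots> = 0" by (simp only: sq E[symmetric])
    finally have "fst p * ((d_z lam p)\<^sup>2 + exp (- 2 * lam p) * (d_rho V p)\<^sup>2) = 0" .
    then have "(d_z lam p)\<^sup>2 + exp (- 2 * lam p) * (d_rho V p)\<^sup>2 = 0" using r by simp
    moreover have "(d_z lam p)\<^sup>2 > 0" "exp (- 2 * lam p) * (d_rho V p)\<^sup>2 \<ge> 0" using nz by simp_all
    ultimately show False by linarith
  qed
  then show ?thesis using mu by (intro coordinate_normal_formI) simp
qed

text \<open>Here \<open>\<kappa> 1 = \<kappa> 4\<close> gives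
  \<open>d_rho mu = 2 * d_rho lam\<close>. Compatibility conditions show that
  \<open>d_rho lam\<close> and \<open>d_z lam\<close> are never both nonzero, the field equation for
  \<open>d_rho mu\<close> that they are never both zero; connectedness selects one of them
  globally.\<close>

lemma normal_form_z:
  assumes V: "\<And>p. p \<in> U \<Longrightarrow> d_rho V p = 0" "\<And>p. p \<in> U \<Longrightarrow> d_z V p \<noteq> 0"
    "\<And>p. p \<in> U \<Longrightarrow> \<kappa> 1 p = \<kappa> 4 p"
    and D: "\<And>p. p \<in> U \<Longrightarrow> \<kappa> 3 p \<noteq> \<kappa> 4 p"
  shows "coordinate_normal_form \<or> cone_normal_form"
proof -
  let ?g = "d_z V"
  have sg: "smooth_on ?g U" by (rule smooth_on_d_z[OF smooth(3)])
  note grad_lr = has_grad_smooth[OF smooth_on_d_rho[OF smooth(1)]]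
    and grad_lz = has_grad_smooth[OF smooth_on_d_z[OF smooth(1)]]
  have mu_r: "d_rho mu p = 2 * d_rho lam p" if p: "p \<in> U" for p
    using has_grad_eq_on_open(1)[OF open_U p V(3) \<kappa>_grad[OF p] \<kappa>_grad[OF p]] V(3)[OF p] D[OF p]
    by (simp add: weyl_dlog_def)
  have mu_z: "d_z mu p = 2 * fst p * d_rho lam p * d_z lam p" if p: "p \<in> U" for p
    using field_equations(4)[OF p] V(1)[OF p] by simp
  have gr: "d_rho ?g p = 0" if p: "p \<in> U" for p
    using mixed_partials[OF smooth(3) p] grad_zero_on(2)[OF V(1) p] by simp
  have gz: "d_z ?g p = 2 * d_z lam p * ?g p" if p: "p \<in> U" for p
    using field_equations(2)[OF p] V(1)[OF p] grad_zero_on(1)[OF V(1) p] by simp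
  have mixed: "d_rho (d_z lam) p = 0" if p: "p \<in> U" for p
  proof -
    have "d_rho (d_z ?g) p = 0"
      using mixed_partials[OF sg p] grad_zero_on(2)[OF gr p] by simp
    then show ?thesis
      using has_grad_eq_on_open(1)[OF open_U p gz has_grad_smooth[OF smooth_on_d_z[OF sg] p]
          has_grad_mult[OF has_grad_mult[OF has_grad_const grad_lz[OF p]] has_grad_smooth[OF sg p]]]
        gr[OF p] V(2)[OF p] by simp
  qed
  \<comment> \<open>\<open>\<kappa> 4\<close> has no z derivative, so the z derivative of its rho
    equation vanishes.\<close>
  have prod: "d_rho lam p * (d_z mu p - d_z lam p) = 0" if p: "p \<in> U" for p
  proof -
    have "d_z (d_rho (\<kappa> 4)) p = 0"
      using mixed_partials[OF smooth_\<kappa> p, of 4] grad_zero_on(1)[OF _ p, of "d_z (\<kappa> 4)"] \<kappa>_z by simp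
    moreover have "d_rho (\<kappa> 4) q = 2 * d_rho lam q * (\<kappa> 4 q - \<kappa> 3 q)" if "q \<in> U" for q
      using \<kappa>_rho[OF that, of 4] mu_r[OF that] by (simp add: weyl_dlog_def)
    ultimately show ?thesis
      using has_grad_eq_on_open(2)[OF open_U p _ has_grad_smooth[OF smooth_on_d_rho[OF smooth_\<kappa>] p]
        has_grad_mult[OF has_grad_mult[OF has_grad_const[of 2] grad_lr[OF p]]
          has_grad_diff[OF \<kappa>_grad[OF p] \<kappa>_grad[OF p]]], of 4 4 3]
        mixed[OF p] mixed_partials[OF smooth(1) p] D[OF p]
      by (simp add: weyl_dlog_def)
  qed
  have disj: "d_rho lam p = 0 \<or> d_z lam p = 0" if p: "p \<in> U" for p
  proof (rule ccontr)
    assume nz: "\<not> (d_rho lam p = 0 \<or> d_z lam p = 0)"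
    let ?N = "{q \<in> U. d_rho lam q \<noteq> 0} \<inter> {q \<in> U. d_z lam q \<noteq> 0}"
    have N: "open ?N"
      by (intro open_Int open_nonzero_set open_U continuous_d_z continuous_d_rho smooth)
    have lr: "2 * fst q * d_rho lam q = 1" if "q \<in> ?N" for q
      using prod[of q] mu_z[of q] that by auto
    have lrr: "2 * d_rho lam q + 2 * fst q * d_rho (d_rho lam) q = 0" if "q \<in> ?N" for q
      using has_grad_eq_on_open(1)[OF N that lr has_grad_mult[OF has_grad_mult[OF
          has_grad_const has_grad_fst] grad_lr] has_grad_const] that by simp
    have "d_rho (d_rho lam) q + d_rho lam q / fst q = 0" if "q \<in> ?N" for q
      using lrr[OF that] fst_pos[of q] that by (simp add: field_simps)
    \<comment> \<open>The radial part of the Laplacian vanishes for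
      \<open>d_rho lam = 1 / (2 * fst q)\<close>. The left side has zero rho derivative, whereas the
      right side changes with \<open>lam\<close>: a contradiction.\<close>
    then have lzz: "d_z (d_z lam) q = exp ((-2) * lam q) * (?g q * ?g q)" if "q \<in> ?N" for q
      using field_equations(1)[of q] that V(1)[of q] by (simp add: power2_eq_square)
    have "d_rho (d_z (d_z lam)) p = 0"
      using mixed_partials[OF smooth_on_d_z[OF smooth(1)] p] grad_zero_on(2)[OF mixed p] by simp
    then have "d_rho lam p * (exp ((-2) * lam p) * (?g p * ?g p)) = 0"
      using has_grad_eq_on_open(1)[OF N _ lzz
          has_grad_smooth[OF smooth_on_d_z[OF smooth_on_d_z[OF smooth(1)]] p]
          has_grad_mult[OF has_grad_exp[OF has_grad_mult[OF has_grad_const lam_grad[OF p]]]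
            has_grad_mult[OF has_grad_smooth[OF sg p] has_grad_smooth[OF sg p]]]] p nz gr[OF p]
      by simp
    then show False using nz V(2)[OF p] by simp
  qed
  have "d_rho lam p \<noteq> 0 \<or> d_z lam p \<noteq> 0" if p: "p \<in> U" for p
    using field_equations(3)[OF p] mu_r[OF p] V[OF p] fst_pos[OF p] by auto
  then have "U \<subseteq> {q \<in> U. d_rho lam q \<noteq> 0} \<union> {q \<in> U. d_z lam q \<noteq> 0}"
    "{q \<in> U. d_rho lam q \<noteq> 0} \<inter> {q \<in> U. d_z lam q \<noteq> 0} \<inter> U = {}"
    using disj by auto
  moreover have "open {q \<in> U. d_rho lam q \<noteq> 0}" "open {q \<in> U. d_z lam q \<noteq> 0}"
    by (intro open_nonzero_set open_U continuous_d_z continuous_d_rho smooth)+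
  ultimately have "(\<forall>q\<in>U. d_rho lam q = 0) \<or> (\<forall>q\<in>U. d_z lam q = 0)"
    using connectedD[OF connected_U] by blast
  then show ?thesis
  proof
    assume "\<forall>q\<in>U. d_rho lam q = 0"
    then have cone_normal_form using mu_r mu_z V(3) by (intro cone_normal_formI) simp
    then show ?thesis ..
  next
    assume "\<forall>q\<in>U. d_z lam q = 0"
    then have coordinate_normal_form using mu_z by (intro coordinate_normal_formI) simp
    then show ?thesis ..
  qed
qed

lemma normal_form:
  assumes align: "\<And>p. p \<in> U \<Longrightarrow> d_rho V p * (\<kappa> 3 p - \<kappa> 1 p) = 0"
      "\<And>p. p \<in> U \<Longrightarrow> d_z V p * (\<kappa> 4 p - \<kappa> 1 p) = 0"
    and nonconst: "\<not> V constant_on U"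
  shows "coordinate_normal_form \<or> cone_normal_form"
proof (cases "\<exists>p\<in>U. \<kappa> 3 p = \<kappa> 4 p")
  case True
  then obtain p where p: "p \<in> U" "\<kappa> 3 p - \<kappa> 4 p = 0" by auto
  have "\<kappa> 3 x - \<kappa> 4 x = 0" if x: "x \<in> U" for x
  proof (rule proportional_grad_vanishes[where f = "\<lambda>x. \<kappa> 3 x - \<kappa> 4 x", OF open_U connected_U _ _ _ p x])
    show "has_grad (\<lambda>p. \<kappa> 3 p - \<kappa> 4 p) ((\<kappa> 3 p - \<kappa> 4 p) * (2 * (d_rho mu p - d_rho lam p)))
        ((\<kappa> 3 p - \<kappa> 4 p) * (2 * (d_z mu p - d_z lam p))) p" if "p \<in> U" for p
      by (rule has_grad_eq[OF has_grad_diff[OF \<kappa>_grad[OF that] \<kappa>_grad[OF that]]])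
        (simp_all add: weyl_dlog_def algebra_simps)
  qed (intro continuous_intros continuous_d_rho continuous_d_z smooth)+
  then show ?thesis by (intro disjI1 coordinate_normal_formI) auto
next
  case False
  then have D: "\<kappa> 3 p \<noteq> \<kappa> 4 p" if "p \<in> U" for p using that by blast
  have "d_rho V p * d_z V p = 0" if "p \<in> U" for p
    \<comment> \<open>Were both derivatives nonzero, \<open>\<kappa> 3\<close> and
      \<open>\<kappa> 4\<close> would both equal \<open>\<kappa> 1\<close>.\<close>
    using align[OF that] D[OF that] by auto
  from one_dimensional_potential[OF this nonconst] show ?thesis
  proof
    assume "\<forall>p\<in>U. d_z V p = 0 \<and> d_rho V p \<noteq> 0"
    then show ?thesis using align(1) D by (intro disjI1 normal_form_rho) auto
  next
    assume "\<forall>p\<in>U. d_rho V p = 0 \<and> d_z V p \<noteq> 0"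
    then show ?thesis using align(2) D by (intro normal_form_z) auto
  qed
qed

end

section \<open>The canonical form\<close>

text \<open>The diagonal entries of the canonical form divided by those of the metric. The factors
  \<open>1\<close> and \<open>- 1\<close> give every branch the shape
  \<open>a * f p + b * h p\<close> used for smoothness.\<close>

definition canonical_eigenvalue ::
    "real \<Rightarrow> (real \<times> real \<Rightarrow> real) \<Rightarrow> (real \<times> real \<Rightarrow> real) \<Rightarrow> (real \<times> real \<Rightarrow> real)
      \<Rightarrow> (real \<times> real \<Rightarrow> real) \<Rightarrow> 4 \<Rightarrow> real \<times> real \<Rightarrow> real"
  where "canonical_eigenvalue q l0 l1 l2 l3 i p =
    (if i = 1 then (1 + q) / 2 * l0 p + 1 * l1 p
     else if i = 2 then - (1 + q) / 2 * l0 p + 1 * l1 p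
     else if i = 3 then - 1 * l2 p + - 1 * l3 p
     else - 1 * l2 p + 1 * l3 p)"

lemma smooth_on_canonical_eigenvalue:
  assumes "open U" "smooth_on l0 U" "smooth_on l1 U" "smooth_on l2 U" "smooth_on l3 U"
  shows "smooth_on (canonical_eigenvalue q l0 l1 l2 l3 i) U"
proof -
  have c: "smooth_on (\<lambda>p. a * f p + b * h p) U" if "smooth_on f U" "smooth_on h U"
    for a b :: real and f h
    using that assms(1) by (intro smooth_on_add smooth_on_cmult)
  show ?thesis
    unfolding canonical_eigenvalue_def[abs_def]
    using exhaust_4[of i] c[OF assms(2,3), of "(1 + q) / 2" 1] c[OF assms(2,3), of "- (1 + q) / 2" 1]
      c[OF assms(4,5), of "- 1" "- 1"] c[OF assms(4,5), of "- 1" 1]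
    by (elim disjE) simp_all
qed

text \<open>The coframe is written with real covectors: \<open>theta1\<close> and
  \<open>theta2\<close> are multiples of \<open>a\<close> and \<open>b\<close>, while
  \<open>theta3\<close> and \<open>theta4\<close> are multiples of \<open>c + \<i> * d\<close> and
  its conjugate, so the symmetric combinations are real.\<close>

lemma canonical_form_components:
  assumes "complex_of_real k = canonical_form lam mu q l0 l1 l2 l3 x m n"
  shows "k = (if m = n then canonical_eigenvalue q l0 l1 l2 l3 m (pt x) * weyl_diag lam mu m (pt x)
    else if {m, n} = {1, 2} then x $ 3 * ((1 - q) / 2 * l0 (pt x)) else 0)"
proof -
  define E r F where "E = exp (lam (pt x))" and "r = x $ 3 * exp (- lam (pt x))"
    and "F = exp (mu (pt x) - lam (pt x))"
  define a b c d :: "4 \<Rightarrow> real" where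
    "a i = (if i = 1 then E else if i = 2 then r else 0)" and
    "b i = (if i = 1 then E else if i = 2 then - r else 0)" and
    "c i = (if i = 3 then - F else 0)" and "d i = (if i = 4 then F else 0)" for i
  define h where "h = complex_of_real (1 / sqrt 2)"
  have hh: "h * h = 1 / 2"
    by (simp add: h_def flip: of_real_mult)
  have h: "h * y * (h * z) = y * z / 2" for y z
    using hh by (metis (no_types, lifting) mult.assoc mult.commute mult.left_commute mult_1 times_divide_eq_left)
  have t1: "theta1 lam x $ i = h * a i" and t2: "theta2 lam x $ i = h * b i" for i
    by (simp_all add: theta1_def theta2_def axis_def a_def b_def E_def r_def h_def)
  have t3: "theta3 lam mu x $ i = h * (c i + \<i> * d i)"
    and t4: "theta4 lam mu x $ i = h * (c i - \<i> * d i)" for i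
    by (simp_all add: theta3_def theta4_def axis_def c_def d_def F_def h_def)
  have "canonical_form lam mu q l0 l1 l2 l3 x m n = complex_of_real
      (l0 (pt x) * (a m * a n / 2 + q * (b m * b n / 2)) + l1 (pt x) * (a m * b n / 2 + b m * a n / 2)
        + l2 (pt x) * (c m * c n + d m * d n) + l3 (pt x) * (c m * c n - d m * d n))"
    unfolding canonical_form_def tensor_prod_def t1 t2 t3 t4 h
    by (simp add: algebra_simps add_divide_distrib diff_divide_distrib)
  then have k: "k = l0 (pt x) * (a m * a n / 2 + q * (b m * b n / 2))
      + l1 (pt x) * (a m * b n / 2 + b m * a n / 2)
      + l2 (pt x) * (c m * c n + d m * d n) + l3 (pt x) * (c m * c n - d m * d n)"
    using assms by (simp only: of_real_eq_iff)
  \<comment> \<open>The t, phi entry carries the product \<open>E * r\<close>, in which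
    \<open>lam\<close> cancels.\<close>
  have x3: "x $ 3 = E * r" by (simp add: E_def r_def exp_minus)
  have "exp (2 * lam (pt x)) = E * E" "exp (- 2 * lam (pt x)) * (x $ 3)\<^sup>2 = r * r"
    "exp (- 2 * lam (pt x)) * exp (2 * mu (pt x)) = F * F"
    by (simp_all add: E_def r_def F_def power2_eq_square flip: exp_add)
  then have G: "weyl_diag lam mu 1 (pt x) = E * E" "weyl_diag lam mu 2 (pt x) = - (r * r)"
    "weyl_diag lam mu 3 (pt x) = - (F * F)" "weyl_diag lam mu 4 (pt x) = - (F * F)"
    by (simp_all add: weyl_diag_def) (simp add: pt_def)
  show ?thesis
    using exhaust_4[of m] exhaust_4[of n] unfolding k x3
    by (elim disjE; simp add: a_def b_def c_def d_def canonical_eigenvalue_def G doubleton_eq_iff;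
        simp add: algebra_simps add_divide_distrib diff_divide_distrib)
qed

theorem mainTheorem4:
  fixes U :: "(real \<times> real) set"
    and lam mu V l0 l1 l2 l3 :: "real \<times> real \<Rightarrow> real"
    and q :: real
    and K :: "real^4 \<Rightarrow> real^4^4"
  assumes "weyl_electrovac U lam mu V"
    and "\<not> V constant_on U"
    and "q \<in> {0, 1, -1}"
    and "smooth_on l0 U" and "smooth_on l1 U" and "smooth_on l2 U" and "smooth_on l3 U"
    and "\<forall>x \<in> weyl_domain U. \<forall>m n.
      complex_of_real (K x $ m $ n) = canonical_form lam mu q l0 l1 l2 l3 x m n"
    and "killing_tensor2 (weyl_metric lam mu) (weyl_domain U) K"
    and "aligned (weyl_metric lam mu) (weyl_domain U) (maxwell (weyl_potential V)) K"
  shows "reducible (weyl_metric lam mu) (weyl_domain U) K"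
proof -
  interpret weyl U lam mu V using assms(1) by unfold_locales
  define \<kappa> where "\<kappa> = canonical_eigenvalue q l0 l1 l2 l3"
  define S where "S p = fst p * ((1 - q) / 2 * l0 p)" for p
  have K: "K x $ m $ n = (if m = n then \<kappa> m (pt x) * G m (pt x)
      else if {m, n} = {1, 2} then S (pt x) else 0)" if "x \<in> M" for x m n
    using canonical_form_components[OF assms(8)[rule_format, OF that]]
    by (simp add: \<kappa>_def S_def pt_def)
  have diag: "K x $ i $ i = \<kappa> i (pt x) * G i (pt x)" if "x \<in> M" for x i
    using K[OF that] by simp
  have K12: "K x $ 1 $ 2 = S (pt x)" "K x $ 2 $ 1 = S (pt x)" if "x \<in> M" for x
    using K[OF that, of 1 2] K[OF that, of 2 1] by (simp_all add: insert_commute)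
  have off: "K x $ i $ j = 0" if "x \<in> M" "i \<noteq> j" "{i, j} \<noteq> {1, 2}" for x i j
    using K[OF that(1)] that by simp
  have smooth_\<kappa>: "smooth_on (\<kappa> i) U" for i
    unfolding \<kappa>_def by (intro smooth_on_canonical_eigenvalue open_U assms)
  have grad_\<kappa>: "has_grad (\<kappa> i) (d_rho (\<kappa> i) p) (d_z (\<kappa> i) p) p" if "p \<in> U" for i p
    by (rule has_grad_smooth[OF smooth_\<kappa> that])
  have grad_S: "has_grad S (d_rho S p) (d_z S p) p" if p: "p \<in> U" for p
  proof -
    have "has_grad S (1 * ((1 - q) / 2 * l0 p) + fst p * (0 * l0 p + (1 - q) / 2 * d_rho l0 p))
        (0 * ((1 - q) / 2 * l0 p) + fst p * (0 * l0 p + (1 - q) / 2 * d_z l0 p)) p"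
      unfolding S_def[abs_def]
      by (intro has_grad_mult has_grad_fst has_grad_const has_grad_smooth[OF assms(4) p])
    from has_grad_eq[OF this has_gradD[OF this, symmetric]] show ?thesis .
  qed
  have killing: "d_rho (\<kappa> i) p = 2 * L i 3 p * (\<kappa> i p - \<kappa> 3 p)"
      "d_z (\<kappa> i) p = 2 * L i 4 p * (\<kappa> i p - \<kappa> 4 p)"
      "d_rho S p = S p * (2 / fst p)" "d_z S p = 0" if "p \<in> U" for p i
    by (rule killing_tensor_equations[where S = S and \<kappa> = \<kappa>, OF assms(9)];
        simp add: diag K12 off grad_\<kappa> grad_S that)+
  have aligned: "d_rho V p * (\<kappa> 3 p - \<kappa> 1 p) = 0" "d_z V p * (\<kappa> 4 p - \<kappa> 1 p) = 0"
      "d_rho V p * S p = 0" "d_z V p * S p = 0" if "p \<in> U" for p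
    by (rule aligned_equations[where S = S and \<kappa> = \<kappa>, OF assms(10)];
        simp add: diag K12 off that)+
  interpret weyl_killing U lam mu V \<kappa>
    using smooth_\<kappa> killing(1,2) by unfold_locales
  \<comment> \<open>A single nonzero value would make \<open>S\<close> nonzero everywhere, and
    alignment would then force \<open>V\<close> to be constant.\<close>
  have "S x = 0" if x: "x \<in> U" for x
  proof (rule ccontr)
    assume "S x \<noteq> 0"
    have "S p \<noteq> 0" if "p \<in> U" for p
    proof
      assume "S p = 0"
      have "S x = 0"
      proof (rule proportional_grad_vanishes[where f = S, OF open_U connected_U _ _ _ that \<open>S p = 0\<close> x])
        show "has_grad S (S p * (2 / fst p)) (S p * 0) p" if "p \<in> U" for p
          using grad_S[OF that] killing(3,4)[OF that] by simp
      qed (simp_all add: continuous_fst_inverse)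
      with \<open>S x \<noteq> 0\<close> show False ..
    qed
    then have "d_rho V p = 0" "d_z V p = 0" if "p \<in> U" for p
      using aligned(3,4)[OF that] that by auto
    then have "\<exists>c. \<forall>p\<in>U. V p = c"
      using V_grad by (intro has_grad_zero_imp_constant[OF open_U connected_U]) force
    then show False using assms(2) by (simp add: constant_on_def)
  qed
  then have off0: "K x $ i $ j = 0" if "x \<in> M" "i \<noteq> j" for x i j
    using K[OF that(1)] that pt_in by simp
  from normal_form[OF aligned(1,2) assms(2)] show ?thesis
  proof
    assume coordinate_normal_form
    then obtain c0 c where c: "c 3 = 0" "c 4 = 0 \<or> (\<forall>p\<in>U. d_z lam p = 0 \<and> d_z mu p = 0)"
      "\<And>p i. p \<in> U \<Longrightarrow> \<kappa> i p = c0 + c i * G i p"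
      unfolding coordinate_normal_form_def by blast
    show ?thesis
      by (rule reducible_by_coordinate_fields[OF diag off0 c(3,1,2)])
  next
    assume cone_normal_form
    then obtain c0 c c' b where "\<And>p. p \<in> U \<Longrightarrow> d_rho lam p = 0 \<and> mu p = b \<and> \<kappa> 1 p = c0 \<and>
      \<kappa> 4 p = c0 \<and> \<kappa> 3 p = c0 + c * G 3 p \<and> \<kappa> 2 p = c0 + c * G 3 p + c' * G 2 p"
      unfolding cone_normal_form_def by metis
    then show ?thesis
      by (intro reducible_by_cone_translations[OF diag off0]) auto
  qed
qed

end
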